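(* Every graph $G$ is $\lfloor\frac23 \operatorname{mad}(G)+1\rfloor$-choosable with clustering $57\lfloor\frac{2}{3}\operatorname{mad}(G)\rfloor+6$.
   Context: Graphs are finite and simple. $\operatorname{mad}(G)$ is the maximum, over all subgraphs $H$ of $G$, of the average degree of $H$. In a coloured graph the monochromatic subgraph is the spanning subgraph of edges whose endpoints have the same colour; its connected components are monochromatic components. A colouring has clustering $c$ if every monochromatic component has at most $c$ vertices. A $k$-list-assignment $L$ assigns to each vertex $v$ a set $L(v)$ of at least $k$ colours; an $L$-colouring colours each $v$ with a colour from $L(v)$. $G$ is $k$-choosable with clustering $c$ if for every $k$-list-assignment $L$, $G$ has an $L$-colouring with clustering $c$. *)

theory Defs
  imports Complex_Main "Graph_Theory.Graph_Theory"
begin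

text \<open>
  A finite simple graph is a \<^locale>\<open>pair_graph\<close>: a finite loop-free digraph whose arcs are a
  symmetric set of ordered pairs. An undirected edge \<open>uv\<close> is thus represented by the two arcs
  \<open>(u, v)\<close> and \<open>(v, u)\<close>, and the degree of \<open>v\<close> is its out-degree.
\<close>

definition average_degree :: "'a pair_pre_digraph \<Rightarrow> real" where
  "average_degree H =
     (\<Sum>v\<in>pverts H. real (out_degree (with_proj H) v)) / real (card (pverts H))"

text \<open>
  The condition \<^term>\<open>pair_graph H\<close> excludes subdigraphs that keep only one of the two arcs of an edge.
  The null subgraph is not excluded; its average degree is \<open>0 / 0 = 0\<close>, which affects no maximum,
  since all average degrees are nonnegative. It makes \<open>mad\<close> equal to 0 on the null graph.
\<close>

definition mad :: "'a pair_pre_digraph \<Rightarrow> real" where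
  "mad G = Max {average_degree H | H. pair_graph H \<and> subgraph (with_proj H) (with_proj G)}"

definition monochromatic_subgraph ::
    "'a pair_pre_digraph \<Rightarrow> ('a \<Rightarrow> 'c) \<Rightarrow> 'a pair_pre_digraph" where
  "monochromatic_subgraph G f =
     \<lparr>pverts = pverts G, parcs = {(u, v) \<in> parcs G. f u = f v}\<rparr>"

definition monochromatic_component ::
    "'a pair_pre_digraph \<Rightarrow> ('a \<Rightarrow> 'c) \<Rightarrow> ('a, 'a \<times> 'a) pre_digraph \<Rightarrow> bool" where
  "monochromatic_component G f H \<longleftrightarrow>
     pre_digraph.max_subgraph (with_proj (monochromatic_subgraph G f)) Digraph_Component.connected H"

definition has_clustering :: "'a pair_pre_digraph \<Rightarrow> ('a \<Rightarrow> 'c) \<Rightarrow> nat \<Rightarrow> bool" where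
  "has_clustering G f c \<longleftrightarrow> (\<forall>H. monochromatic_component G f H \<longrightarrow> card (verts H) \<le> c)"

text \<open>Colour lists may be infinite, in which case their \<^const>\<open>card\<close> is 0.\<close>

definition list_assignment :: "'a pair_pre_digraph \<Rightarrow> nat \<Rightarrow> ('a \<Rightarrow> 'c set) \<Rightarrow> bool" where
  "list_assignment G k L \<longleftrightarrow> (\<forall>v\<in>pverts G. infinite (L v) \<or> k \<le> card (L v))"

definition list_colouring :: "'a pair_pre_digraph \<Rightarrow> ('a \<Rightarrow> 'c set) \<Rightarrow> ('a \<Rightarrow> 'c) \<Rightarrow> bool" where
  "list_colouring G L f \<longleftrightarrow> (\<forall>v\<in>pverts G. f v \<in> L v)"

text \<open>
  The type of colours is an explicit parameter, because a definition cannot quantify over types.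
  Choosability in the usual sense is this predicate for every type \<open>'c\<close>.
\<close>

definition choosable_with_clustering ::
    "'c itself \<Rightarrow> 'a pair_pre_digraph \<Rightarrow> nat \<Rightarrow> nat \<Rightarrow> bool" where
  "choosable_with_clustering (_ :: 'c itself) G k c \<longleftrightarrow>
     (\<forall>L :: 'a \<Rightarrow> 'c set. list_assignment G k L \<longrightarrow>
        (\<exists>f. list_colouring G L f \<and> has_clustering G f c))"

end

theory Submission
  imports Defs
begin

text \<open>
  Let \<open>k = \<lfloor>2/3 mad G\<rfloor> + 1\<close>, so that \<open>mad G < 3k/2\<close>. A weighted minimality argument yields a nonempty
  vertex set \<open>A\<close> such that, once the rest has been coloured and the colours of outside neighbours have
  been deleted from the lists, every nonempty \<open>S \<subseteq> A\<close> satisfies \<open>2 e(S) < \<Sum>v\<in>S. s(v)\<close>, where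
  \<open>s(v) = 3 |L(v)| - deg(v)\<close> is the slack of \<open>v\<close>. So it suffices to colour \<open>A\<close>.

  In a colouring of \<open>A\<close> with the fewest monochromatic edges all monochromatic degrees are at most 2, so
  components are paths and cycles. A vertex \<open>v\<close> of monochromatic degree 2 has at least \<open>s(v) - 1\<close>
  neutral colours: recolouring \<open>v\<close> with one of them keeps the colouring optimal, and it joins \<open>v\<close> only
  to two end vertices of components. By the inequality above, a path segment with \<open>m\<close> inner vertices has at
  least \<open>m - 1\<close> neutral recolourings. Two recolourings conflict if they would make a common component
  grow. Optimality forces the recolourings that attach nonadjacently to the same component to come from
  a clique, cliques have at most \<open>k\<close> vertices by the inequality, and so there are at most \<open>5k - 3\<close>
  conflicts with each recolouring. Haxell's theorem on independent transversals then selects one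
  recolouring in each segment of length \<open>m = 10k - 5\<close> without conflicts, which cuts all long
  components and creates none of more than \<open>4m + 1\<close> vertices. This needs \<open>k \<ge> 2\<close>; for \<open>k = 1\<close>
  the inequality alone bounds connected sets by 3 vertices.
\<close>

section \<open>Connected vertex sets of a symmetric relation\<close>

definition arc_count :: "'a rel \<Rightarrow> 'a set \<Rightarrow> 'a set \<Rightarrow> nat" where
  "arc_count R X Y = (\<Sum>u\<in>X. card (R `` {u} \<inter> Y))"

lemma arc_count_empty [simp]: "arc_count R {} Y = 0" "arc_count R X {} = 0"
  by (simp_all add: arc_count_def)

lemma arc_count_Un_left:
  assumes "finite X" "finite X'" "X \<inter> X' = {}"
  shows "arc_count R (X \<union> X') Y = arc_count R X Y + arc_count R X' Y"
  unfolding arc_count_def using assms by (rule sum.union_disjoint)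

lemma card_Image_Int: "finite Y \<Longrightarrow> card (R `` {u} \<inter> Y) = (\<Sum>v\<in>Y. of_bool ((u, v) \<in> R))"
  by (simp add: sum.If_cases of_bool_def Int_def Image_def conj_commute)

lemma arc_count_Un_right:
  assumes "finite Y" "finite Y'" "Y \<inter> Y' = {}"
  shows "arc_count R X (Y \<union> Y') = arc_count R X Y + arc_count R X Y'"
  unfolding arc_count_def
  using assms by (simp only: card_Image_Int finite_Un sum.union_disjoint sum.distrib simp_thms)

lemma arc_count_commute:
  assumes "finite X" "finite Y" "sym R"
  shows "arc_count R X Y = arc_count R Y X"
proof -
  have "arc_count R X Y = (\<Sum>u\<in>X. \<Sum>v\<in>Y. of_bool ((u, v) \<in> R))"
    using assms by (simp add: arc_count_def card_Image_Int)
  also have "\<dots> = (\<Sum>v\<in>Y. \<Sum>u\<in>X. of_bool ((u, v) \<in> R))" by (rule sum.swap)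
  also have "\<dots> = (\<Sum>v\<in>Y. \<Sum>u\<in>X. of_bool ((v, u) \<in> R))"
    using symD[OF assms(3)] by (intro sum.cong refl) (simp, blast)
  also have "\<dots> = arc_count R Y X"
    using assms by (simp add: arc_count_def card_Image_Int)
  finally show ?thesis .
qed

lemma arc_count_mono:
  assumes "finite X'" "finite Y'" "X \<subseteq> X'" "Y \<subseteq> Y'"
  shows "arc_count R X Y \<le> arc_count R X' Y'"
proof -
  have "arc_count R X Y \<le> (\<Sum>u\<in>X. card (R `` {u} \<inter> Y'))"
    unfolding arc_count_def using assms by (intro sum_mono card_mono) auto
  also have "\<dots> \<le> arc_count R X' Y'"
    unfolding arc_count_def using assms by (intro sum_mono2) auto
  finally show ?thesis .
qed

lemma arc_count_ge_1:
  assumes "finite X" "finite Y" "x \<in> X" "y \<in> Y" "(x, y) \<in> R"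
  shows "1 \<le> arc_count R X Y"
proof -
  have "1 \<le> card (R `` {x} \<inter> Y)"
    using assms card_gt_0_iff[of "R `` {x} \<inter> Y"] by (auto simp: Suc_le_eq)
  also have "\<dots> \<le> arc_count R X Y"
    unfolding arc_count_def using assms by (intro member_le_sum) auto
  finally show ?thesis .
qed

lemma arc_count_insert:
  assumes "finite X" "y \<notin> X" "sym R" "irrefl R"
  shows "arc_count R (insert y X) (insert y X) = arc_count R X X + 2 * arc_count R {y} X"
proof -
  have fin: "finite {y}" by simp
  have dis: "{y} \<inter> X = {}" using assms by auto
  have 0: "arc_count R {y} {y} = 0"
    using assms(4) by (auto simp: arc_count_def irrefl_def)
  have "arc_count R ({y} \<union> X) ({y} \<union> X) = arc_count R X X + 2 * arc_count R {y} X"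
    unfolding arc_count_Un_left[OF fin assms(1) dis] arc_count_Un_right[OF fin assms(1) dis]
    using 0 arc_count_commute[OF assms(1) fin assms(3)] by simp
  then show ?thesis by simp
qed

text \<open>Every edge inside \<open>X\<close> is counted once from each end, so
  \<open>arc_count R X X\<close> is twice the number of edges. This doubled count replaces edge
  counts throughout.\<close>

lemma even_arc_count:
  assumes "finite X" "sym R" "irrefl R"
  shows "even (arc_count R X X)"
  using assms(1) by induction (simp_all add: arc_count_insert assms)

text \<open>Connectivity of the subgraph induced on \<open>Q\<close>, encoded by cuts instead of
  paths, because the counting arguments need just one arc across a given cut. The empty set counts
  as linked.\<close>

definition linked :: "'a rel \<Rightarrow> 'a set \<Rightarrow> bool" where
  "linked R Q \<longleftrightarrow> (\<forall>X\<subseteq>Q. X \<noteq> {} \<longrightarrow> X \<noteq> Q \<longrightarrow> (\<exists>x\<in>X. \<exists>y\<in>Q - X. (x, y) \<in> R))"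

lemma linkedE:
  assumes "linked R Q" "X \<subseteq> Q" "X \<noteq> {}" "X \<noteq> Q"
  obtains x y where "x \<in> X" "y \<in> Q" "y \<notin> X" "(x, y) \<in> R"
  using assms unfolding linked_def by blast

lemma linked_sing [simp]: "linked R {x}"
  by (auto simp: linked_def)

lemma linked_mono: "linked R Q \<Longrightarrow> R \<inter> Q \<times> Q \<subseteq> R' \<Longrightarrow> linked R' Q"
  unfolding linked_def
  by (intro allI impI, elim allE impE, assumption+, elim bexE) auto

lemma linked_insert:
  assumes "linked R X" "sym R" "x \<in> X" "(x, y) \<in> R"
  shows "linked R (insert y X)"
  unfolding linked_def
proof (intro allI impI)
  fix Z assume Z: "Z \<subseteq> insert y X" "Z \<noteq> {}" "Z \<noteq> insert y X"
  show "\<exists>a\<in>Z. \<exists>b\<in>insert y X - Z. (a, b) \<in> R"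
  proof (cases "Z \<inter> X = {} \<or> X \<subseteq> Z")
    case True
    then show ?thesis
    proof
      assume "Z \<inter> X = {}"
      then have "y \<in> Z" "x \<notin> Z" using Z assms(3) by auto
      then show ?thesis using assms(3) symD[OF assms(2,4)] by blast
    next
      assume "X \<subseteq> Z"
      then have "y \<notin> Z" using Z by auto
      then show ?thesis using \<open>X \<subseteq> Z\<close> assms(3,4) by blast
    qed
  next
    case False
    then obtain a b where "a \<in> Z \<inter> X" "b \<in> X" "b \<notin> Z \<inter> X" "(a, b) \<in> R"
      using linkedE[OF assms(1), of "Z \<inter> X"] by blast
    then show ?thesis by blast
  qed
qed

text \<open>Adding the far end of an arc that leaves the current set keeps the set linked and gains
  at least one edge, as in building a spanning tree. Smaller \<open>n\<close> yields segments of
  prescribed size, \<open>n = card Q\<close> the tree bound \<open>linked_arc_count\<close>.\<close>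

lemma linked_grow:
  assumes "finite Q" "linked R Q" "sym R" "irrefl R" "1 \<le> n" "n \<le> card Q"
  shows "\<exists>X\<subseteq>Q. card X = n \<and> linked R X \<and> 2 * n \<le> arc_count R X X + 2"
  using assms(5,6)
proof (induction n rule: nat_induct_at_least)
  case base
  then obtain x where "x \<in> Q" by fastforce
  then show ?case by (intro exI[of _ "{x}"]) auto
next
  case (Suc n)
  then obtain X where X: "X \<subseteq> Q" "card X = n" "linked R X" "2 * n \<le> arc_count R X X + 2" by auto
  have "X \<noteq> {}" "X \<noteq> Q" using X Suc by auto
  then obtain x y where xy: "x \<in> X" "y \<in> Q" "y \<notin> X" "(x, y) \<in> R"
    using linkedE[OF assms(2) X(1)] by blast
  have fX: "finite X" using X assms(1) finite_subset by blast
  have "1 \<le> arc_count R {y} X" using xy fX symD[OF assms(3) xy(4)] by (intro arc_count_ge_1[of _ _ y x]) auto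
  then have "2 * Suc n \<le> arc_count R (insert y X) (insert y X) + 2"
    using X arc_count_insert[OF fX xy(3) assms(3,4)] by simp
  then show ?case
    using X xy fX linked_insert[OF X(3) assms(3) xy(1,4)]
    by (intro exI[of _ "insert y X"]) auto
qed

lemma linked_arc_count:
  assumes "finite Q" "linked R Q" "sym R" "irrefl R"
  shows "2 * card Q \<le> arc_count R Q Q + 2"
proof (cases "Q = {}")
  case False
  then obtain X where "X \<subseteq> Q" "card X = card Q" "2 * card Q \<le> arc_count R X X + 2"
    using linked_grow[OF assms, of "card Q"] assms(1) by (auto simp: Suc_le_eq card_gt_0_iff)
  then show ?thesis using card_subset_eq[OF assms(1)] by auto
qed simp

lemma linked_rtrancl:
  assumes "sym R"
  shows "linked R (R\<^sup>* `` {x})"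
  unfolding linked_def
proof (intro allI impI, rule ccontr)
  fix X assume X: "X \<subseteq> R\<^sup>* `` {x}" "X \<noteq> {}" "X \<noteq> R\<^sup>* `` {x}"
    and no: "\<not> (\<exists>a\<in>X. \<exists>b\<in>R\<^sup>* `` {x} - X. (a, b) \<in> R)"
  have closed: "b \<in> X" if "(a, b) \<in> R\<^sup>*" "a \<in> X" for a b
    using that
  proof (induction rule: rtrancl_induct)
    case (step b c)
    then have "c \<in> R\<^sup>* `` {x}" using X(1) by (auto intro: rtrancl_into_rtrancl)
    then show ?case using step no by blast
  qed
  obtain z where z: "z \<in> X" using X by auto
  then have "(z, x) \<in> R\<^sup>*" using X sym_rtrancl[OF assms] by (auto dest: symD)
  then have "x \<in> X" using closed z by blast
  then have "R\<^sup>* `` {x} \<subseteq> X" using closed by blast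
  then show False using X by blast
qed

text \<open>Splitting along cuts crossed by no arc until only linked sets remain produces the
  components of the subgraph induced on \<open>X\<close>.\<close>

lemma linked_partition:
  assumes "finite X" "sym R"
  shows "\<exists>P. \<Union>P = X \<and> pairwise disjnt P \<and> (\<forall>C\<in>P. C \<noteq> {} \<and> linked R C) \<and>
    (\<forall>C\<in>P. \<forall>x\<in>C. \<forall>y\<in>X - C. (x, y) \<notin> R)"
  using assms(1)
proof (induction "card X" arbitrary: X rule: less_induct)
  case less
  show ?case
  proof (cases "linked R X")
    case True
    then show ?thesis by (intro exI[of _ "if X = {} then {} else {X}"]) auto
  next
    case False
    then obtain Y where Y: "Y \<subseteq> X" "Y \<noteq> {}" "Y \<noteq> X" and sep: "\<forall>x\<in>Y. \<forall>y\<in>X - Y. (x, y) \<notin> R"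
      unfolding linked_def by blast
    have "card Y < card X" "finite Y" "card (X - Y) < card X" "finite (X - Y)"
      using Y less.prems finite_subset[OF Y(1)] by (auto intro!: psubset_card_mono)
    note IH = less.hyps[OF this(1,2)] less.hyps[OF this(3,4)]
    obtain P where P: "\<Union>P = Y" "pairwise disjnt P" "\<forall>C\<in>P. C \<noteq> {} \<and> linked R C"
        "\<forall>C\<in>P. \<forall>x\<in>C. \<forall>y\<in>Y - C. (x, y) \<notin> R"
      using IH(1) by (elim exE conjE)
    obtain P' where P': "\<Union>P' = X - Y" "pairwise disjnt P'" "\<forall>C\<in>P'. C \<noteq> {} \<and> linked R C"
        "\<forall>C\<in>P'. \<forall>x\<in>C. \<forall>y\<in>X - Y - C. (x, y) \<notin> R"
      using IH(2) by (elim exE conjE)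
    have "pairwise disjnt (P \<union> P')"
      using P(1,2) P'(1,2) unfolding pairwise_def disjnt_def by blast
    moreover have "(x, y) \<notin> R" if "C \<in> P \<union> P'" "x \<in> C" "y \<in> X - C" for C x y
    proof (cases "C \<in> P")
      case True
      then show ?thesis using P(1,4) sep that by (cases "y \<in> Y") auto
    next
      case False
      then have "C \<in> P'" "x \<in> X - Y" using that P'(1) by auto
      then show ?thesis using P'(4) sep that symD[OF assms(2), of x y] by (cases "y \<in> Y") auto
    qed
    moreover have "\<Union>(P \<union> P') = X" using P(1) P'(1) Y(1) by auto
    moreover have "\<forall>C\<in>P \<union> P'. C \<noteq> {} \<and> linked R C" using P(3) P'(3) by blast
    ultimately show ?thesis by (intro exI[of _ "P \<union> P'"] conjI) blast+
  qed
qed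

text \<open>If a cut of \<open>C - {x}\<close> were crossed by no arc, both of its sides would have
  to be joined to \<open>x\<close>, giving \<open>x\<close> two neighbours.\<close>

lemma linked_remove:
  assumes "linked R C" "sym R" "finite R" "card (R `` {x}) \<le> 1"
  shows "linked R (C - {x})"
  unfolding linked_def
proof (intro allI impI, rule ccontr)
  fix X assume X: "X \<subseteq> C - {x}" "X \<noteq> {}" "X \<noteq> C - {x}"
    and no: "\<not> (\<exists>a\<in>X. \<exists>b\<in>C - {x} - X. (a, b) \<in> R)"
  let ?Y = "C - {x} - X"
  have "X \<subseteq> C" "X \<noteq> C" using X by auto
  then obtain a b where ab: "a \<in> X" "b \<in> C" "b \<notin> X" "(a, b) \<in> R"
    using linkedE[OF assms(1)] X(2) by metis
  then have b: "b = x" using no by blast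
  have "?Y \<subseteq> C" "?Y \<noteq> {}" "?Y \<noteq> C" using X by auto
  then obtain a' b' where ab': "a' \<in> ?Y" "b' \<in> C" "b' \<notin> ?Y" "(a', b') \<in> R"
    using linkedE[OF assms(1)] by metis
  then have "b' = x" using no symD[OF assms(2)] by blast
  then have "{a, a'} \<subseteq> R `` {x}" "a \<noteq> a'" using ab ab' b symD[OF assms(2)] by blast+
  moreover have "finite (R `` {x})" using assms(3) by (simp add: finite_Image)
  ultimately have "2 \<le> card (R `` {x})" by (metis card_2_iff card_mono)
  then show False using assms(4) by simp
qed

lemma linked_Diff:
  assumes "finite L" "linked R C" "sym R" "finite R" "\<And>x. x \<in> L \<Longrightarrow> card (R `` {x}) \<le> 1"
  shows "linked R (C - L)"
  using assms(1,5)
proof (induction L)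
  case (insert x L)
  then have "linked R (C - L - {x})" using assms(3,4) by (intro linked_remove) auto
  then show ?case by (metis Diff_insert)
qed (use assms in simp)

section \<open>Haxell's theorem on independent transversals\<close>

lemma lexn_less_thanI:
  assumes "length xs = n" "length ys = n" "i < n" "\<And>j. j < i \<Longrightarrow> xs ! j = ys ! j" "xs ! i < ys ! i"
  shows "(xs, ys) \<in> lexn less_than n"
proof -
  have "take i xs = take i ys" using assms by (intro nth_equalityI) auto
  then have "xs = take i ys @ xs ! i # drop (Suc i) xs" "ys = take i ys @ ys ! i # drop (Suc i) ys"
    using assms id_take_nth_drop[of i xs] id_take_nth_drop[of i ys] by auto
  then show ?thesis
    unfolding lexn_conv using assms(1,2,5) by blast
qed

text \<open>
  Grow a sequence \<open>ws\<close> of vertices in parts reached so far, where the parts blocked by a new vertex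
  are reached next. While every vertex of \<open>ws\<close> blocks a part, the \<open>r\<close> reached parts have at least \<open>2 D r\<close>
  vertices, but fewer are adjacent to \<open>ws\<close> or to the transversal in the blocked parts, so \<open>ws\<close> can be
  extended. Swapping a vertex that blocks no part into the transversal frees a part blocked by an
  earlier one, which decreases the vector of the numbers of blocked parts lexicographically.
\<close>

lemma independent_transversal_insert:
  fixes H :: "'b \<Rightarrow> 'b \<Rightarrow> bool" and p :: "'b \<Rightarrow> 'i"
  assumes "finite I" "a \<notin> I" "finite W" "symp H" "0 < D"
    and deg: "\<And>b. b \<in> W \<Longrightarrow> card {b' \<in> W. H b b'} \<le> D"
    and size: "\<And>i. i \<in> insert a I \<Longrightarrow> 2 * D \<le> card {b \<in> W. p b = i}"
    and t0: "\<forall>i\<in>I. t0 i \<in> W \<and> p (t0 i) = i" "\<forall>i\<in>I. \<forall>j\<in>I. i \<noteq> j \<longrightarrow> \<not> H (t0 i) (t0 j)"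
  shows "\<exists>t. (\<forall>i\<in>insert a I. t i \<in> W \<and> p (t i) = i) \<and>
    (\<forall>i\<in>insert a I. \<forall>j\<in>insert a I. i \<noteq> j \<longrightarrow> \<not> H (t i) (t j))"
proof -
  define N where "N = card I"
  define B where "B t w = {i\<in>I. H w (t i)}" for t w
  define good where "good t \<longleftrightarrow> (\<forall>i\<in>I. t i \<in> W \<and> p (t i) = i) \<and>
    (\<forall>i\<in>I. \<forall>j\<in>I. i \<noteq> j \<longrightarrow> \<not> H (t i) (t j))" for t
  define step where "step t ws j \<longleftrightarrow> ws ! j \<in> W \<and> (p (ws ! j) = a \<or> (\<exists>i<j. p (ws ! j) \<in> B t (ws ! i))) \<and>
    (\<forall>i<j. \<not> H (ws ! i) (ws ! j) \<and> (\<forall>q\<in>B t (ws ! i). \<not> H (t q) (ws ! j)))" for t ws j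
  define valid where "valid t ws \<longleftrightarrow> good t \<and> (\<forall>j<length ws. step t ws j) \<and>
    (\<forall>j. Suc j < length ws \<longrightarrow> B t (ws ! j) \<noteq> {})" for t ws
  \<comment> \<open>Positions beyond the end of \<open>ws\<close> hold \<open>Suc N\<close>, more
    than any number of blocked parts, so that appending a vertex decreases the vector.\<close>
  define vec where "vec t ws = map (\<lambda>j. if j < length ws then card (B t (ws ! j)) else Suc N) [0..<Suc N]"
    for t ws
  have symH: "H x y \<Longrightarrow> H y x" for x y using \<open>symp H\<close> by (rule sympD)
  have finB: "finite (B t w)" and BI: "B t w \<subseteq> I" for t w using \<open>finite I\<close> by (auto simp: B_def)
  \<comment> \<open>A later vertex avoids the representatives of all parts blocked earlier, so no
    part is blocked twice.\<close>
  have disj: "B t (ws ! i) \<inter> B t (ws ! j) = {}" if "step t ws j" "i < j" for t ws i j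
    using that symH unfolding step_def B_def by blast
  have "valid t ws \<Longrightarrow> ?thesis" for t ws
  proof (induction "vec t ws" arbitrary: t ws rule: wf_induct_rule[OF wf_lexn[OF wf_less_than, of "Suc N"]])
    case (1 t ws)
    have good: "good t" and steps: "\<And>j. j < length ws \<Longrightarrow> step t ws j"
      and ne: "\<And>j. Suc j < length ws \<Longrightarrow> B t (ws ! j) \<noteq> {}"
      using 1(2) by (auto simp: valid_def)
    have sum_card: "(\<Sum>j<n. card (B t (ws ! j))) = card (\<Union>j<n. B t (ws ! j))" if "n \<le> length ws" for n
    proof (rule card_UN_disjoint[symmetric])
      show "\<forall>i\<in>{..<n}. \<forall>j\<in>{..<n}. i \<noteq> j \<longrightarrow> B t (ws ! i) \<inter> B t (ws ! j) = {}"
        using disj steps that by (metis inf_commute lessThan_iff linorder_neqE_nat order_less_le_trans)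
    qed (use finB in auto)
    have sum_le: "card (\<Union>j<n. B t (ws ! j)) \<le> N" for n
      unfolding N_def using \<open>finite I\<close> BI by (intro card_mono) auto
    show ?case
    proof (cases "ws \<noteq> [] \<and> B t (last ws) = {}")
      case True
      define m where "m = length ws - 1"
      define w where "w = ws ! m"
      have m: "m < length ws" "length ws = Suc m" and w: "B t w = {}"
        using True by (auto simp: m_def w_def last_conv_nth)
      have st: "step t ws m" using steps m by blast
      have wW: "w \<in> W" using st by (simp add: step_def w_def)
      have free: "\<not> H w (t i)" "\<not> H (t i) w" if "i \<in> I" for i
        using w that symH by (auto simp: B_def)
      show ?thesis
      proof (cases "p w = a")
        case True
        let ?t = "t(a := w)"
        have "(\<forall>i\<in>insert a I. ?t i \<in> W \<and> p (?t i) = i) \<and>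
          (\<forall>i\<in>insert a I. \<forall>j\<in>insert a I. i \<noteq> j \<longrightarrow> \<not> H (?t i) (?t j))"
          using good wW free \<open>a \<notin> I\<close> True by (auto simp: good_def)
        then show ?thesis by blast
      next
        case False
        then obtain i where i: "i < m" "p w \<in> B t (ws ! i)"
          using st by (auto simp: step_def w_def)
        define q where "q = p w"
        have q: "q \<in> I" "q \<in> B t (ws ! i)" using i BI by (auto simp: q_def)
        define t' where "t' = t(q := w)"
        define ws' where "ws' = take (Suc i) ws"
        have len: "length ws' = Suc i" using i m by (simp add: ws'_def)
        have nth: "ws' ! j = ws ! j" if "j \<le> i" for j using that by (simp add: ws'_def)
        have qn: "q \<notin> B t (ws ! j)" if "j < i" for j
          using disj[OF steps, of i j] that q i m by auto
        have Hw: "\<not> H (ws ! j) w" if "j < m" for j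
          using st that by (auto simp: step_def w_def)
        have B_eq: "B t' (ws ! j) = B t (ws ! j) - {q}" if "j \<le> i" for j
          using Hw[of j] that i by (auto simp: B_def t'_def)
        have B_eq': "B t' (ws ! j) = B t (ws ! j)" if "j < i" for j
          using B_eq[of j] qn[of j] that by auto
        have "good t'"
          using good wW free q by (auto simp: good_def t'_def q_def)
        moreover have "step t' ws' j" if "j < length ws'" for j
        proof -
          have j: "j \<le> i" "j < length ws" using that len i m by auto
          have "t' r = t r" if "l < j" "r \<in> B t (ws ! l)" for l r
            using qn[of l] that j by (auto simp: t'_def)
          then show ?thesis
            using steps[OF j(2)] j B_eq' by (auto simp: step_def nth)
        qed
        moreover have "B t' (ws' ! j) \<noteq> {}" if "Suc j < length ws'" for j
          using that len B_eq'[of j] ne[of j] i m by (simp add: nth)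
        ultimately have valid: "valid t' ws'" by (simp add: valid_def)
        \<comment> \<open>The blocked sets up to position \<open>i\<close> are nonempty, disjoint
          and contained in \<open>I\<close>; hence \<open>i\<close> is a position of the
          vector.\<close>
        have "N \<ge> Suc i"
        proof -
          have "Suc i = (\<Sum>j<Suc i. 1)" by simp
          also have "\<dots> \<le> (\<Sum>j<Suc i. card (B t (ws ! j)))"
          proof (rule sum_mono)
            fix j assume "j \<in> {..<Suc i}"
            then have "B t (ws ! j) \<noteq> {}" using ne[of j] i m by auto
            then show "1 \<le> card (B t (ws ! j))" using finB by (simp add: Suc_le_eq card_gt_0_iff)
          qed
          also have "\<dots> \<le> N" using sum_card[of "Suc i"] sum_le i m by simp
          finally show ?thesis .
        qed
        then have "(vec t' ws', vec t ws) \<in> lexn less_than (Suc N)"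
        proof (intro lexn_less_thanI[of _ _ _ i])
          fix j assume "j < i"
          then show "vec t' ws' ! j = vec t ws ! j"
            using \<open>Suc i \<le> N\<close> len i m B_eq'[of j] by (simp add: vec_def nth del: upt_Suc)
        next
          have "card (B t' (ws ! i)) < card (B t (ws ! i))"
            unfolding B_eq[OF order_refl] using finB q(2) by (rule card_Diff1_less)
          then show "vec t' ws' ! i < vec t ws ! i"
            using \<open>Suc i \<le> N\<close> len i m by (simp add: vec_def nth del: upt_Suc)
        qed (use \<open>Suc i \<le> N\<close> in \<open>simp_all add: vec_def\<close>)
        then show ?thesis using 1(1) valid by blast
      qed
    next
      case False
      define n where "n = length ws"
      define BB where "BB = (\<Union>j<n. B t (ws ! j))"
      have ne': "B t (ws ! j) \<noteq> {}" if "j < n" for j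
      proof (cases "Suc j = n")
        case True
        then have len: "length ws = Suc j" by (simp add: n_def)
        then have "ws \<noteq> []" by auto
        moreover from this have "last ws = ws ! j" using last_conv_nth[of ws] len by simp
        ultimately show ?thesis using False by simp
      qed (use ne[of j] that in \<open>simp add: n_def\<close>)
      have BB: "finite BB" "BB \<subseteq> I" "card BB \<le> N" "(\<Sum>j<n. card (B t (ws ! j))) = card BB"
      proof -
        show "BB \<subseteq> I" unfolding BB_def by (intro UN_least BI)
        then show "finite BB" using \<open>finite I\<close> by (rule finite_subset)
        show "card BB \<le> N" unfolding BB_def by (rule sum_le)
        show "(\<Sum>j<n. card (B t (ws ! j))) = card BB"
          unfolding BB_def by (rule sum_card) (simp add: n_def)
      qed
      have "n = (\<Sum>j<n. 1)" by simp
      also have "\<dots> \<le> (\<Sum>j<n. card (B t (ws ! j)))"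
        using ne' finB by (intro sum_mono) (simp add: Suc_le_eq card_gt_0_iff)
      finally have n: "n \<le> card BB" using BB by simp
      define X where "X = set ws \<union> t ` BB"
      have "set ws \<subseteq> W" using steps by (auto simp: step_def in_set_conv_nth)
      moreover have "t ` BB \<subseteq> W" using good BB(2) by (auto simp: good_def)
      ultimately have XW: "X \<subseteq> W" "finite X" using BB(1) by (auto simp: X_def)
      have "card X \<le> card (set ws) + card (t ` BB)" unfolding X_def by (rule card_Un_le)
      also have "\<dots> \<le> n + card BB"
        using BB(1) by (intro add_mono) (simp_all add: n_def card_length card_image_le)
      finally have cX: "card X \<le> 2 * card BB" using n by simp
      define Dom where "Dom = (\<Union>x\<in>X. {b' \<in> W. H x b'})"
      have "card Dom \<le> (\<Sum>x\<in>X. card {b' \<in> W. H x b'})"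
        unfolding Dom_def using XW by (intro card_UN_le)
      also have "\<dots> \<le> (\<Sum>x\<in>X. D)" using XW deg by (intro sum_mono) auto
      also have "\<dots> \<le> 2 * card BB * D" using cX by simp
      \<comment> \<open>The reached parts are those in \<open>BB\<close> together with
        \<open>a\<close>; the extra part makes the inequality strict.\<close>
      also have "\<dots> < (\<Sum>i\<in>insert a BB. 2 * D)"
        using BB \<open>a \<notin> I\<close> \<open>0 < D\<close> by (subst sum.insert) auto
      also have "\<dots> \<le> (\<Sum>i\<in>insert a BB. card {b \<in> W. p b = i})"
        using size BB by (intro sum_mono) auto
      also have "\<dots> = card (\<Union>i\<in>insert a BB. {b \<in> W. p b = i})"
        using BB \<open>finite W\<close> by (intro card_UN_disjoint[symmetric]) auto
      finally have "card Dom < card (\<Union>i\<in>insert a BB. {b \<in> W. p b = i})" .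
      moreover have "finite Dom" using XW \<open>finite W\<close> by (auto simp: Dom_def)
      ultimately have "\<not> (\<Union>i\<in>insert a BB. {b \<in> W. p b = i}) \<subseteq> Dom"
        using card_mono leD by blast
      then obtain w where w: "w \<in> W" "p w = a \<or> p w \<in> BB" "w \<notin> Dom" by blast
      define ws' where "ws' = ws @ [w]"
      have nth: "ws' ! j = ws ! j" if "j < n" for j using that by (simp add: ws'_def n_def nth_append)
      have "step t ws' j" if "j < length ws'" for j
      proof (cases "j < n")
        case True
        then show ?thesis using steps[of j] by (auto simp: step_def nth n_def)
      next
        case False
        then have j: "j = n" using that by (simp add: ws'_def n_def)
        then have wj: "ws' ! j = w" by (simp add: ws'_def n_def)
        have "\<not> H (ws ! i) w" if "i < n" for i
          using w that by (auto simp: Dom_def X_def n_def)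
        moreover have "\<not> H (t r) w" if "r \<in> BB" for r
          using w that by (auto simp: Dom_def X_def)
        ultimately show ?thesis
          using w unfolding step_def wj unfolding j by (auto simp: nth BB_def)
      qed
      moreover have "B t (ws' ! j) \<noteq> {}" if "Suc j < length ws'" for j
        using that ne'[of j] nth[of j] by (simp add: ws'_def n_def)
      ultimately have valid: "valid t ws'" using good by (simp add: valid_def)
      have "n \<le> N" using n BB by simp
      then have "(vec t ws', vec t ws) \<in> lexn less_than (Suc N)"
      proof (intro lexn_less_thanI[of _ _ _ n])
        fix j assume "j < n"
        then show "vec t ws' ! j = vec t ws ! j"
          using \<open>n \<le> N\<close> by (simp add: vec_def nth n_def ws'_def nth_append del: upt_Suc)
      next
        have "card (B t w) \<le> N" unfolding N_def using \<open>finite I\<close> BI by (intro card_mono)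
        then show "vec t ws' ! n < vec t ws ! n"
          using \<open>n \<le> N\<close> by (simp add: vec_def n_def ws'_def del: upt_Suc)
      qed (use \<open>n \<le> N\<close> in \<open>simp_all add: vec_def\<close>)
      then show ?thesis using 1(1) valid by blast
    qed
  qed
  moreover have "valid t0 []" using t0 by (simp add: valid_def good_def)
  ultimately show ?thesis by blast
qed

theorem independent_transversal:
  fixes H :: "'b \<Rightarrow> 'b \<Rightarrow> bool" and p :: "'b \<Rightarrow> 'i"
  assumes "finite I" "finite W" "symp H" "0 < D"
    and "\<And>b. b \<in> W \<Longrightarrow> card {b' \<in> W. H b b'} \<le> D"
    and "\<And>i. i \<in> I \<Longrightarrow> 2 * D \<le> card {b \<in> W. p b = i}"
  shows "\<exists>t. (\<forall>i\<in>I. t i \<in> W \<and> p (t i) = i) \<and> (\<forall>i\<in>I. \<forall>j\<in>I. i \<noteq> j \<longrightarrow> \<not> H (t i) (t j))"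
  using assms(1,6)
proof (induction I)
  case (insert a I)
  have "\<exists>t. (\<forall>i\<in>I. t i \<in> W \<and> p (t i) = i) \<and> (\<forall>i\<in>I. \<forall>j\<in>I. i \<noteq> j \<longrightarrow> \<not> H (t i) (t j))"
    using insert.prems by (intro insert.IH) simp
  then obtain t where t: "\<forall>i\<in>I. t i \<in> W \<and> p (t i) = i"
    "\<forall>i\<in>I. \<forall>j\<in>I. i \<noteq> j \<longrightarrow> \<not> H (t i) (t j)"
    by (elim exE conjE)
  show ?case
    by (rule independent_transversal_insert[OF insert.hyps assms(2-5) insert.prems t])
qed simp

section \<open>Pieces of paths and cycles\<close>

lemma arc_count_UN:
  assumes "finite I" "\<And>i. i \<in> I \<Longrightarrow> finite (X i)" "\<And>i j. i \<in> I \<Longrightarrow> j \<in> I \<Longrightarrow> i \<noteq> j \<Longrightarrow> X i \<inter> X j = {}"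
  shows "arc_count R (\<Union>i\<in>I. X i) Y = (\<Sum>i\<in>I. arc_count R (X i) Y)"
  unfolding arc_count_def using assms by (intro sum.UNION_disjoint) auto

locale max_degree_two =
  fixes A :: "'a set" and R :: "'a rel"
  assumes finite_A: "finite A" and R_sub: "R \<subseteq> A \<times> A" and sym_R: "sym R" and irrefl_R: "irrefl R"
    and degree_le_2: "\<And>v. v \<in> A \<Longrightarrow> card (R `` {v}) \<le> 2"
begin

text \<open>In the paths and cycles that make up \<open>R\<close>, these are the ends of paths,
  isolated vertices included.\<close>

definition low :: "'a set" where
  "low = {v \<in> A. card (R `` {v}) \<le> 1}"

lemma finite_R: "finite R"
  using R_sub finite_A by (meson finite_SigmaI finite_subset)

lemma arc_count_split:
  assumes "X \<subseteq> Y" "Y \<subseteq> A"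
  shows "arc_count R Z Y = arc_count R Z X + arc_count R Z (Y - X)"
proof -
  have "arc_count R Z (X \<union> (Y - X)) = arc_count R Z X + arc_count R Z (Y - X)"
    using assms finite_A by (intro arc_count_Un_right) (auto intro: finite_subset)
  then show ?thesis using assms(1) by (simp add: Un_absorb1)
qed

lemma arc_count_degree_sum: "arc_count R Q A = (\<Sum>v\<in>Q. card (R `` {v}))"
proof -
  have "R `` {v} \<inter> A = R `` {v}" for v using R_sub by auto
  then show ?thesis by (simp add: arc_count_def)
qed

text \<open>The degrees on \<open>Q\<close> sum to at most \<open>2 * card Q\<close>, and each low
  vertex lowers this bound by one, whereas a linked set has at least \<open>2 * card Q - 2\<close>
  arcs inside. The difference of 2 also has to pay for the arcs leaving \<open>Q\<close>.\<close>

lemma boundary: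
  assumes "Q \<subseteq> A" "linked R Q"
  shows "arc_count R Q (A - Q) + card (Q \<inter> low) \<le> 2"
proof -
  have fin: "finite Q" using assms(1) finite_A by (rule finite_subset)
  have "(\<Sum>v\<in>Q. card (R `` {v}) + of_bool (v \<in> low)) \<le> (\<Sum>v\<in>Q. 2)"
  proof (rule sum_mono)
    fix v assume "v \<in> Q"
    then show "card (R `` {v}) + of_bool (v \<in> low) \<le> 2"
      using degree_le_2[of v] assms(1) by (auto simp: low_def)
  qed
  moreover have "(\<Sum>v\<in>Q. of_bool (v \<in> low)) = card (Q \<inter> low)"
    using fin by (simp add: sum.If_cases of_bool_def)
  ultimately have "arc_count R Q A + card (Q \<inter> low) \<le> 2 * card Q"
    by (simp add: arc_count_degree_sum sum.distrib)
  then show ?thesis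
    using linked_arc_count[OF fin assms(2) sym_R irrefl_R] arc_count_split[OF assms(1) order_refl, of Q] by simp
qed

text \<open>A parity argument: a proper part of a path sends at least as many arcs into the rest of the
  path as it sends out of the path.\<close>

lemma arcs_leaving_le:
  assumes S: "S \<subseteq> A" "linked R S" "\<And>v. v \<in> S \<Longrightarrow> card (R `` {v}) = 2"
    and X: "X \<subseteq> S" "X \<noteq> {}" "X \<noteq> S"
  shows "1 \<le> arc_count R X (S - X)" "arc_count R X (A - S) \<le> arc_count R X (S - X)"
proof -
  have fin: "finite S" "finite X" "finite (S - X)" "finite (A - S)"
    using S(1) X(1) finite_A by (auto intro: finite_subset)
  obtain x y where "x \<in> X" "y \<in> S" "y \<notin> X" "(x, y) \<in> R"
    using linkedE[OF S(2) X] by blast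
  then show 1: "1 \<le> arc_count R X (S - X)" using fin by (intro arc_count_ge_1[of _ _ x y]) auto
  have "S = X \<union> (S - X)" using X(1) by auto
  then have "arc_count R S (A - S) = arc_count R X (A - S) + arc_count R (S - X) (A - S)"
    using arc_count_Un_left[of X "S - X" R "A - S"] fin by auto
  then have 2: "arc_count R X (A - S) + arc_count R (S - X) (A - S) \<le> 2"
    using boundary[OF S(1,2)] by simp
  show "arc_count R X (A - S) \<le> arc_count R X (S - X)"
  proof (cases "arc_count R X (A - S) \<le> 1")
    case True
    then show ?thesis using 1 by simp
  next
    case False
    \<comment> \<open>Both arcs out of \<open>S\<close> start in \<open>X\<close>, so all arcs from
      \<open>S - X\<close> stay in \<open>S\<close>. Their number \<open>2 * card (S - X)\<close> is
      even, and so is the number of arcs inside \<open>S - X\<close>. Hence the positive number of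
      arcs between \<open>X\<close> and \<open>S - X\<close> is even, that is, at least 2.\<close>
    then have "arc_count R (S - X) (A - S) = 0" using 2 by simp
    moreover have "arc_count R (S - X) A = 2 * card (S - X)"
      using S(3) by (simp add: arc_count_degree_sum)
    moreover have "arc_count R (S - X) A = arc_count R (S - X) X + arc_count R (S - X) (S - X)
        + arc_count R (S - X) (A - S)"
      using arc_count_split[OF S(1) order_refl] arc_count_split[OF X(1) S(1)] by simp
    ultimately have "2 * card (S - X) = arc_count R (S - X) X + arc_count R (S - X) (S - X)" by simp
    then have "even (arc_count R (S - X) X)"
      using even_arc_count[OF fin(3) sym_R irrefl_R] by (metis dvd_triv_left even_add)
    then have "even (arc_count R X (S - X))"
      using arc_count_commute[OF fin(2,3) sym_R] by simp
    then show ?thesis using 1 2 by presburger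
  qed
qed

text \<open>Each segment met by \<open>Q\<close> is left by an arc out of \<open>Q\<close>, so
  \<open>boundary\<close> allows at most two of them, each contributing at most \<open>m - 1\<close>
  vertices. The rest of \<open>Q\<close> falls into at most two gaps, which by maximality have at
  most \<open>m - 1\<close> vertices each besides low ones. A low vertex of \<open>Q\<close> uses up
  one end, which halves the bound.\<close>

lemma card_piece:
  assumes segments: "\<forall>S\<in>F. S \<subseteq> A \<and> linked R S \<and> card S = m \<and> S \<inter> low = {}"
    and disj: "pairwise disjnt F" and m: "1 \<le> m"
    and maximal: "\<forall>C\<subseteq>A. linked R C \<longrightarrow> C \<inter> low = {} \<longrightarrow> C \<inter> \<Union>F = {} \<longrightarrow> card C < m"
    and Q: "Q \<subseteq> A" "linked R Q" "\<forall>S\<in>F. \<not> S \<subseteq> Q"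
  shows "card Q \<le> 4 * m" "Q \<inter> low \<noteq> {} \<Longrightarrow> card Q \<le> 2 * m"
proof -
  note F = bspec[OF segments]
  define T where "T = Q \<inter> \<Union>F"
  define FT where "FT = {S \<in> F. S \<inter> Q \<noteq> {}}"
  define U where "U = Q - T"
  have finQ: "finite Q" using Q(1) finite_A by (rule finite_subset)
  have "F \<subseteq> Pow A" using F by auto
  then have finF: "finite F" using finite_A by (simp add: finite_subset)
  have fin: "finite T" "finite U" "finite FT" "finite (A - Q)" "finite (Q \<inter> low)"
    using finQ finF finite_A by (auto simp: T_def U_def FT_def)
  have T_UN: "T = (\<Union>S\<in>FT. Q \<inter> S)" by (auto simp: T_def FT_def)
  have dis: "(Q \<inter> S) \<inter> (Q \<inter> S') = {}" if "S \<in> FT" "S' \<in> FT" "S \<noteq> S'" for S S'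
    using disj that unfolding pairwise_def disjnt_def FT_def by blast
  have arcs_T: "arc_count R T Y = (\<Sum>S\<in>FT. arc_count R (Q \<inter> S) Y)" for Y
    unfolding T_UN using fin finQ dis by (intro arc_count_UN) auto
  have seg: "1 \<le> arc_count R (Q \<inter> S) (S - Q)"
      "arc_count R (Q \<inter> S) (A - S) \<le> arc_count R (Q \<inter> S) (S - Q)"
      "card (Q \<inter> S) \<le> m - 1" if "S \<in> FT" for S
  proof -
    have S: "S \<in> F" "S \<inter> Q \<noteq> {}" using that by (auto simp: FT_def)
    have deg: "card (R `` {v}) = 2" if "v \<in> S" for v
    proof -
      have "v \<in> A" "v \<notin> low" using F[OF S(1)] that by auto
      then show ?thesis using degree_le_2[of v] by (auto simp: low_def)
    qed
    have "Q \<inter> S \<noteq> S" using Q(3) S(1) by auto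
    moreover have "S - Q \<inter> S = S - Q" by auto
    ultimately show "1 \<le> arc_count R (Q \<inter> S) (S - Q)"
      "arc_count R (Q \<inter> S) (A - S) \<le> arc_count R (Q \<inter> S) (S - Q)"
      using arcs_leaving_le[of S "Q \<inter> S"] F[OF S(1)] S(2) deg by auto
    have "card (Q \<inter> S) < card S"
      using \<open>Q \<inter> S \<noteq> S\<close> F[OF S(1)] finite_A by (intro psubset_card_mono) (auto intro: finite_subset)
    then show "card (Q \<inter> S) \<le> m - 1" using F[OF S(1)] by simp
  qed
  have "(\<Sum>S\<in>FT. arc_count R (Q \<inter> S) (S - Q)) \<le> (\<Sum>S\<in>FT. arc_count R (Q \<inter> S) (A - Q))"
    using F fin finQ by (intro sum_mono arc_count_mono) (auto simp: FT_def)
  also have "\<dots> = arc_count R T (A - Q)" by (simp add: arcs_T)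
  also have "\<dots> \<le> arc_count R Q (A - Q)"
    using finQ fin by (intro arc_count_mono) (auto simp: T_def)
  finally have out: "(\<Sum>S\<in>FT. arc_count R (Q \<inter> S) (S - Q)) + card (Q \<inter> low) \<le> 2"
    using boundary[OF Q(1,2)] by simp
  have "card FT = (\<Sum>S\<in>FT. 1)" by simp
  also have "\<dots> \<le> (\<Sum>S\<in>FT. arc_count R (Q \<inter> S) (S - Q))" using seg(1) by (rule sum_mono)
  finally have cFT: "card FT + card (Q \<inter> low) \<le> 2" using out by simp
  have "card T \<le> (\<Sum>S\<in>FT. card (Q \<inter> S))" unfolding T_UN using fin by (intro card_UN_le)
  also have "\<dots> \<le> (\<Sum>S\<in>FT. m - 1)" using seg(3) by (rule sum_mono)
  finally have cT: "card T \<le> card FT * (m - 1)" by simp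
  \<comment> \<open>An arc from a segment to \<open>U\<close> leaves that segment, so
    \<open>arcs_leaving_le\<close> charges it to an arc that leaves \<open>Q\<close>.\<close>
  have "arc_count R T U \<le> (\<Sum>S\<in>FT. arc_count R (Q \<inter> S) (A - S))"
    unfolding arcs_T using Q(1) finite_A finQ
    by (intro sum_mono arc_count_mono) (auto simp: U_def T_def FT_def)
  also have "\<dots> \<le> (\<Sum>S\<in>FT. arc_count R (Q \<inter> S) (S - Q))" using seg(2) by (rule sum_mono)
  finally have TU: "arc_count R U T + card (Q \<inter> low) \<le> 2"
    using out arc_count_commute[OF fin(1,2) sym_R] by simp
  \<comment> \<open>Low vertices have degree at most 1, so stripping them keeps a gap linked; it
    then avoids \<open>low\<close> and all segments, and maximality applies.\<close>
  have gap: "card (C - low) \<le> m - 1" if "C \<subseteq> U" "linked R C" for C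
  proof -
    have "linked R (C - low)"
      using that finite_R finite_A sym_R by (intro linked_Diff) (auto simp: low_def)
    moreover have "(C - low) \<inter> \<Union>F = {}" using that by (auto simp: U_def T_def)
    ultimately have "card (C - low) < m"
      using that Q(1) by (intro maximal[rule_format]) (auto simp: U_def)
    then show ?thesis by simp
  qed
  have "card Q \<le> 4 * m \<and> (Q \<inter> low \<noteq> {} \<longrightarrow> card Q \<le> 2 * m)"
  proof (cases "T = {}")
    case True
    have "card Q \<le> card (Q - low) + card (Q \<inter> low)"
      using card_Un_le[of "Q - low" "Q \<inter> low"] by (simp add: Un_Diff_Int)
    moreover have "card (Q - low) \<le> m - 1" using gap[of Q] Q(2) True by (simp add: U_def)
    ultimately have "card Q \<le> m + 1" using cFT m by linarith
    then show ?thesis using m by simp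
  next
    case False
    obtain P where P: "\<Union>P = U" "pairwise disjnt P" "\<forall>C\<in>P. C \<noteq> {} \<and> linked R C"
        "\<forall>C\<in>P. \<forall>x\<in>C. \<forall>y\<in>U - C. (x, y) \<notin> R"
      using linked_partition[OF fin(2) sym_R] by (elim exE conjE)
    have finP: "finite P" "\<And>C. C \<in> P \<Longrightarrow> finite C"
      using P(1) fin(2) by (auto intro: finite_UnionD finite_subset)
    have "card P = (\<Sum>C\<in>P. 1)" by simp
    also have "\<dots> \<le> (\<Sum>C\<in>P. arc_count R C T)"
    proof (rule sum_mono)
      fix C assume C: "C \<in> P"
      then have "C \<subseteq> Q" "C \<noteq> Q" "C \<noteq> {}" using P(1,3) False by (auto simp: U_def T_def)
      then obtain x y where xy: "x \<in> C" "y \<in> Q" "y \<notin> C" "(x, y) \<in> R"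
        using linkedE[OF Q(2), of C] by blast
      then have "y \<in> T" using P(4) C by (auto simp: U_def)
      then show "1 \<le> arc_count R C T" using xy finP C fin by (intro arc_count_ge_1[of _ _ x y]) auto
    qed
    also have "\<dots> = arc_count R (\<Union>C\<in>P. C) T"
      using P(2) finP by (intro arc_count_UN[symmetric]) (auto simp: pairwise_def disjnt_def)
    also have "(\<Union>C\<in>P. C) = U" using P(1) by simp
    finally have cP: "card P + card (Q \<inter> low) \<le> 2" using TU by simp
    have "U \<subseteq> (\<Union>C\<in>P. C - low) \<union> (Q \<inter> low)" using P(1) by (auto simp: U_def)
    then have "card U \<le> card ((\<Union>C\<in>P. C - low) \<union> (Q \<inter> low))"
      using finP fin by (intro card_mono) auto
    also have "\<dots> \<le> card (\<Union>C\<in>P. C - low) + card (Q \<inter> low)" by (rule card_Un_le)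
    also have "card (\<Union>C\<in>P. C - low) \<le> (\<Sum>C\<in>P. card (C - low))" using finP by (intro card_UN_le)
    also have "\<dots> \<le> (\<Sum>C\<in>P. m - 1)" using P(1,3) gap by (intro sum_mono) auto
    finally have cU: "card U \<le> card P * (m - 1) + card (Q \<inter> low)" by simp
    have "card FT \<noteq> 0" using False fin(3) by (auto simp: T_UN)
    then have low1: "card (Q \<inter> low) \<le> 1" using cFT by simp
    have "Q = T \<union> U" by (auto simp: T_def U_def)
    then have "card Q \<le> card T + card U" using card_Un_le[of T U] by simp
    also have "\<dots> \<le> (card FT + card P) * (m - 1) + card (Q \<inter> low)"
      using cT cU by (simp add: algebra_simps)
    also have "\<dots> \<le> (2 * (2 - card (Q \<inter> low))) * (m - 1) + card (Q \<inter> low)"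
      using cP cFT by (intro add_mono mult_right_mono) auto
    finally have le: "card Q \<le> (2 * (2 - card (Q \<inter> low))) * (m - 1) + card (Q \<inter> low)" .
    show ?thesis
    proof (cases "Q \<inter> low = {}")
      case True
      then show ?thesis using le by simp
    next
      case False
      then have "card (Q \<inter> low) = 1" using low1 fin(5) card_gt_0_iff[of "Q \<inter> low"] by linarith
      then have "card Q \<le> 2 * (m - 1) + 1" using le by simp
      then have "card Q \<le> 2 * m" using m by linarith
      then show ?thesis by simp
    qed
  qed
  then show "card Q \<le> 4 * m" "Q \<inter> low \<noteq> {} \<Longrightarrow> card Q \<le> 2 * m" by auto
qed

end

section \<open>Colourings with the fewest monochromatic edges\<close>

lemma sum_of_bool_mem:
  fixes X Y :: "'b set"
  assumes "finite X"
  shows "(\<Sum>c\<in>X. of_bool (c \<in> Y)) = card (X \<inter> Y)"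
  using assms by (simp add: sum.If_cases of_bool_def)

text \<open>The lists have different sizes because colours of neighbours outside \<open>A\<close>
  have been removed from them. Infinite sets have \<open>card\<close> 0, so \<open>lists\<close>
  also forces the lists to be finite.\<close>

locale sparse_lists =
  fixes A :: "'a set" and E :: "'a rel" and l :: "'a \<Rightarrow> 'c set" and k :: nat
  assumes finite_A: "finite A" and E_sub: "E \<subseteq> A \<times> A" and sym_E: "sym E" and irrefl_E: "irrefl E"
    and lists: "\<And>v. v \<in> A \<Longrightarrow> 1 \<le> card (l v) \<and> card (l v) \<le> k"
    and sparse: "\<And>S. S \<subseteq> A \<Longrightarrow> S \<noteq> {} \<Longrightarrow>
      int (arc_count E S S) < (\<Sum>v\<in>S. 3 * int (card (l v)) - int (card (E `` {v})))"
begin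

section \<open>Monochromatic degrees and the effect of recolouring one vertex\<close>

definition mono_arcs :: "('a \<Rightarrow> 'c) \<Rightarrow> 'a rel" where
  "mono_arcs f = {(u, v) \<in> E. f u = f v}"

definition nbrs :: "('a \<Rightarrow> 'c) \<Rightarrow> 'c \<Rightarrow> 'a \<Rightarrow> 'a set" where
  "nbrs f c v = {u \<in> E `` {v}. f u = c}"

definition slack :: "'a \<Rightarrow> int" where
  "slack v = 3 * int (card (l v)) - int (card (E `` {v}))"

text \<open>Twice the number of monochromatic edges, each being counted at both ends.\<close>

definition energy :: "('a \<Rightarrow> 'c) \<Rightarrow> nat" where
  "energy f = (\<Sum>v\<in>A. card (nbrs f (f v) v))"

definition colouring :: "('a \<Rightarrow> 'c) \<Rightarrow> bool" where
  "colouring f \<longleftrightarrow> (\<forall>v\<in>A. f v \<in> l v)"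

definition optimal :: "('a \<Rightarrow> 'c) \<Rightarrow> bool" where
  "optimal f \<longleftrightarrow> colouring f \<and> (\<forall>g. colouring g \<longrightarrow> energy f \<le> energy g)"

text \<open>Equality of the two counts keeps the energy unchanged; the value 2 restricts attention
  to vertices that are not ends of monochromatic paths.\<close>

definition neutral :: "('a \<Rightarrow> 'c) \<Rightarrow> 'a \<Rightarrow> 'c \<Rightarrow> bool" where
  "neutral f v c \<longleftrightarrow> v \<in> A \<and> c \<in> l v \<and> c \<noteq> f v \<and> card (nbrs f (f v) v) = 2 \<and> card (nbrs f c v) = 2"

lemma E_simps: "(u, v) \<in> E \<Longrightarrow> (v, u) \<in> E" "(u, u) \<notin> E" "(u, v) \<in> E \<Longrightarrow> u \<in> A" "(u, v) \<in> E \<Longrightarrow> v \<in> A"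
  using sym_E irrefl_E E_sub by (auto dest: symD simp: irrefl_def)

lemma finite_E_Image [simp]: "finite (E `` {v})"
  using E_sub finite_A by (auto intro: finite_subset)

lemma nbrs_sub: "nbrs f c v \<subseteq> E `` {v}"
  by (auto simp: nbrs_def)

lemma finite_nbrs [simp]: "finite (nbrs f c v)"
  using nbrs_sub finite_E_Image by (rule finite_subset)

lemma finite_list: "v \<in> A \<Longrightarrow> finite (l v)"
  using lists[of v] by (auto intro: card_ge_0_finite)

lemma mono_arcs_Image: "mono_arcs f `` {v} = nbrs f (f v) v"
  by (auto simp: mono_arcs_def nbrs_def)

lemma sym_mono: "sym (mono_arcs f)" and irrefl_mono: "irrefl (mono_arcs f)" and mono_sub: "mono_arcs f \<subseteq> A \<times> A"
  using E_simps by (auto simp: mono_arcs_def sym_def irrefl_def)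

lemma slack_pos: "v \<in> A \<Longrightarrow> 1 \<le> slack v"
  using sparse[of "{v}"] by (simp add: slack_def)

lemma sum_card_nbrs_le:
  assumes "finite C"
  shows "(\<Sum>c\<in>C. card (nbrs f c v)) \<le> card (E `` {v})"
proof -
  have "(\<Sum>c\<in>C. card (nbrs f c v)) = card (\<Union>c\<in>C. nbrs f c v)"
    using assms by (intro card_UN_disjoint[symmetric] ballI impI finite_nbrs) (auto simp: nbrs_def)
  also have "\<dots> \<le> card (E `` {v})" using nbrs_sub by (intro card_mono) auto
  finally show ?thesis .
qed

text \<open>For a neighbour \<open>u\<close> of \<open>v\<close>, recolouring moves \<open>v\<close>
  from one colour class of neighbours to another. Both corrections are added, which avoids truncated
  subtraction.\<close>

lemma card_nbrs_upd:
  assumes "f v \<noteq> c"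
  shows "card (nbrs (f(v := c)) a u) + of_bool ((u, v) \<in> E \<and> f v = a)
    = card (nbrs f a u) + of_bool ((u, v) \<in> E \<and> a = c)"
proof (cases "(u, v) \<in> E")
  case True
  consider "a = c" | "a = f v" | "a \<noteq> c" "a \<noteq> f v" by blast
  then show ?thesis
  proof cases
    case 1
    then have "nbrs (f(v := c)) a u = insert v (nbrs f a u)" "v \<notin> nbrs f a u"
      using True assms by (auto simp: nbrs_def)
    then show ?thesis using 1 True assms by simp
  next
    case 2
    then have "nbrs f a u = insert v (nbrs (f(v := c)) a u)" "v \<notin> nbrs (f(v := c)) a u"
      using True assms by (auto simp: nbrs_def)
    then show ?thesis using 2 True assms by simp
  next
    case 3
    then have "nbrs (f(v := c)) a u = nbrs f a u" by (auto simp: nbrs_def)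
    then show ?thesis using 3 by simp
  qed
next
  case False
  then have "nbrs (f(v := c)) a u = nbrs f a u" by (auto simp: nbrs_def)
  then show ?thesis using False by simp
qed

text \<open>A monochromatic edge at \<open>v\<close> contributes at \<open>v\<close> and at its
  other end, hence the factor 2.\<close>

lemma energy_upd:
  assumes "v \<in> A" "f v \<noteq> c"
  shows "energy (f(v := c)) + 2 * card (nbrs f (f v) v) = energy f + 2 * card (nbrs f c v)"
proof -
  let ?g = "f(v := c)" and ?A = "A - {v}"
  have sum_nbrs: "(\<Sum>u\<in>?A. of_bool ((u, v) \<in> E \<and> f u = a)) = card (nbrs f a v)" for a
  proof -
    have "nbrs f a v = {u \<in> ?A. (u, v) \<in> E \<and> f u = a}"
      using E_simps by (auto simp: nbrs_def)
    then show ?thesis using finite_A by (simp add: sum.If_cases of_bool_def Int_def)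
  qed
  have split: "energy h = card (nbrs h (h v) v) + (\<Sum>u\<in>?A. card (nbrs h (h u) u))" for h
    unfolding energy_def using assms(1) finite_A by (simp add: sum.remove)
  have "nbrs ?g c v = nbrs f c v" using E_simps by (auto simp: nbrs_def)
  moreover have "(\<Sum>u\<in>?A. card (nbrs ?g (?g u) u) + of_bool ((u, v) \<in> E \<and> f u = f v))
      = (\<Sum>u\<in>?A. card (nbrs f (f u) u) + of_bool ((u, v) \<in> E \<and> f u = c))"
  proof (rule sum.cong[OF refl])
    fix u assume "u \<in> ?A"
    then have "?g u = f u" by simp
    then show "card (nbrs ?g (?g u) u) + of_bool ((u, v) \<in> E \<and> f u = f v)
      = card (nbrs f (f u) u) + of_bool ((u, v) \<in> E \<and> f u = c)"
      using card_nbrs_upd[of f v c "f u" u, OF assms(2)] by (simp only: eq_commute[of "f u" "f v"])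
  qed
  ultimately show ?thesis
    unfolding split[of ?g] split[of f] by (simp add: sum.distrib sum_nbrs)
qed

section \<open>Local structure of optimal colourings\<close>

lemma ex_optimal: "\<exists>f. optimal f"
proof -
  have "l v \<noteq> {}" if "v \<in> A" for v using lists[OF that] by auto
  then have "colouring (\<lambda>v. SOME c. c \<in> l v)"
    unfolding colouring_def by (simp add: some_in_eq)
  then show ?thesis
    using ex_has_least_nat[of colouring _ energy] unfolding optimal_def by blast
qed

lemma optimal_le:
  assumes "optimal f" "v \<in> A" "c \<in> l v"
  shows "card (nbrs f (f v) v) \<le> card (nbrs f c v)"
proof (cases "c = f v")
  case False
  have "colouring (f(v := c))" using assms by (auto simp: optimal_def colouring_def)
  then have "energy f \<le> energy (f(v := c))" using assms(1) by (simp add: optimal_def)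
  then show ?thesis using energy_upd[of v f c] assms(2) False by auto
qed simp

lemma optimal_list_degree:
  assumes "optimal f" "v \<in> A"
  shows "card (l v) * card (nbrs f (f v) v) \<le> card (E `` {v})"
proof -
  have "(\<Sum>c\<in>l v. card (nbrs f (f v) v)) \<le> (\<Sum>c\<in>l v. card (nbrs f c v))"
    using optimal_le[OF assms] by (rule sum_mono)
  also have "\<dots> \<le> card (E `` {v})" by (rule sum_card_nbrs_le[OF finite_list[OF assms(2)]])
  finally show ?thesis by simp
qed

text \<open>By optimality every colour of the list occurs on at least as many neighbours as
  \<open>f v\<close>. Three occurrences of each would make the degree at least
  \<open>3 * card (l v)\<close>, contrary to positive slack.\<close>

lemma optimal_degree:
  assumes "optimal f" "v \<in> A"
  shows "card (nbrs f (f v) v) \<le> 2"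
proof (rule ccontr)
  assume "\<not> ?thesis"
  then have "card (l v) * 3 \<le> card (l v) * card (nbrs f (f v) v)" by (intro mult_le_mono2) simp
  then have "card (l v) * 3 \<le> card (E `` {v})" using optimal_list_degree[OF assms] by (rule order_trans)
  then show False using slack_pos[OF assms(2)] by (simp add: slack_def)
qed

lemma optimal_upd:
  assumes "optimal f" "neutral f v c"
  shows "optimal (f(v := c))"
proof -
  have "energy (f(v := c)) = energy f"
    using energy_upd[of v f c] assms(2) by (auto simp: neutral_def)
  moreover have "colouring (f(v := c))"
    using assms by (auto simp: optimal_def colouring_def neutral_def)
  ultimately show ?thesis using assms(1) by (simp add: optimal_def)
qed

lemma neutral_upd:
  assumes "neutral f w c" "w \<noteq> v" "(v, w) \<notin> E"
  shows "neutral (f(v := c')) w c"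
proof -
  have "nbrs (f(v := c')) a w = nbrs f a w" for a
    using assms(3) E_simps(1) by (auto simp: nbrs_def)
  then show ?thesis using assms(1,2) by (simp add: neutral_def)
qed

text \<open>Every colour of the list occurs on at least two neighbours, so the degree is at least
  \<open>2 * card (l v)\<close> and the slack at most \<open>card (l v)\<close>.\<close>

lemma slack_le:
  assumes "optimal f" "v \<in> A" "card (nbrs f (f v) v) = 2"
  shows "slack v \<le> int k"
  using optimal_list_degree[OF assms(1,2)] assms(3) lists[OF assms(2)] by (simp add: slack_def)

text \<open>Each colour of the list occurs on at least two neighbours of \<open>v\<close>, and on at least three of
  them unless it is \<open>f v\<close> or neutral.\<close>

lemma slack_le_neutral:
  assumes "optimal f" "v \<in> A" "card (nbrs f (f v) v) = 2"
  shows "slack v \<le> int (card {c. neutral f v c}) + 1"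
proof -
  let ?N = "{c. neutral f v c}"
  have fin: "finite (l v)" by (rule finite_list[OF assms(2)])
  have N: "?N \<subseteq> l v" "f v \<notin> ?N" by (auto simp: neutral_def)
  have fv: "f v \<in> l v" using assms by (simp add: optimal_def colouring_def)
  have "(\<Sum>c\<in>l v. 3) \<le> (\<Sum>c\<in>l v. card (nbrs f c v) + of_bool (c \<in> insert (f v) ?N))"
  proof (rule sum_mono)
    fix c assume c: "c \<in> l v"
    then have "2 \<le> card (nbrs f c v)" using optimal_le[OF assms(1,2)] assms(3) by metis
    then show "3 \<le> card (nbrs f c v) + of_bool (c \<in> insert (f v) ?N)"
      using assms c by (auto simp: neutral_def)
  qed
  also have "\<dots> = (\<Sum>c\<in>l v. card (nbrs f c v)) + card (l v \<inter> insert (f v) ?N)"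
    unfolding sum.distrib sum_of_bool_mem[OF fin] ..
  also have "l v \<inter> insert (f v) ?N = insert (f v) ?N" using N fv by auto
  also have "card (insert (f v) ?N) = card ?N + 1"
    using N fin finite_subset[OF N(1)] by simp
  finally have "3 * card (l v) \<le> (\<Sum>c\<in>l v. card (nbrs f c v)) + (card ?N + 1)" by simp
  then show ?thesis using sum_card_nbrs_le[OF fin, of f v] by (simp add: slack_def)
qed

lemma max_degree_two_mono: "optimal f \<Longrightarrow> max_degree_two A (mono_arcs f)"
  using finite_A mono_sub sym_mono irrefl_mono optimal_degree
  by unfold_locales (auto simp: mono_arcs_Image)

text \<open>The recoloured \<open>v\<close> raises the monochromatic degree of \<open>x\<close> by
  one, and the new colouring is still optimal. So a neutral recolouring attaches \<open>v\<close> to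
  end vertices only.\<close>

lemma neutral_nbr:
  assumes "optimal f" "neutral f v c" "x \<in> nbrs f c v"
  shows "card (nbrs f c x) \<le> 1"
proof -
  have xv: "(x, v) \<in> E" "x \<in> A" "f x = c" "x \<noteq> v" using assms(3) E_simps by (auto simp: nbrs_def)
  have "c \<noteq> f v" using assms(2) by (simp add: neutral_def)
  then have "card (nbrs (f(v := c)) c x) = card (nbrs f c x) + 1"
    using card_nbrs_upd[of f v c c x] xv(1) by auto
  moreover have "card (nbrs (f(v := c)) c x) \<le> 2"
    using optimal_degree[OF optimal_upd[OF assms(1,2)] xv(2)] xv by simp
  ultimately show ?thesis by simp
qed

text \<open>A clique of \<open>n\<close> vertices has \<open>n * (n - 1)\<close> arcs, which
  \<open>sparse\<close> and \<open>slack_le\<close> bound strictly by \<open>n * k\<close>.\<close>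

lemma card_clique_le:
  assumes "optimal f" "K \<subseteq> A" "\<And>v. v \<in> K \<Longrightarrow> card (nbrs f (f v) v) = 2"
    and "\<And>v w. v \<in> K \<Longrightarrow> w \<in> K \<Longrightarrow> v \<noteq> w \<Longrightarrow> (v, w) \<in> E"
  shows "card K \<le> k"
proof (cases "K = {}")
  case False
  have fin: "finite K" using assms(2) finite_A by (rule finite_subset)
  have "E `` {v} \<inter> K = K - {v}" if "v \<in> K" for v
    using assms(4)[OF that] E_simps by auto
  then have "arc_count E K K = (\<Sum>v\<in>K. card K - 1)"
    using fin by (auto simp: arc_count_def intro!: sum.cong)
  then have "int (card K * (card K - 1)) < (\<Sum>v\<in>K. slack v)"
    using sparse[OF assms(2) False] by (simp add: slack_def)
  also have "\<dots> \<le> (\<Sum>v\<in>K. int k)"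
    using slack_le[OF assms(1)] assms(2,3) by (intro sum_mono) auto
  also have "\<dots> = int (card K * k)" by simp
  finally have "card K * (card K - 1) < card K * k" by (simp only: of_nat_less_iff)
  then have "card K - 1 < k" by simp
  then show ?thesis by simp
qed simp

text \<open>Otherwise recolouring all three vertices would keep the colouring optimal, while it pushes the
  degree sum of the component of \<open>x\<close> above twice its size.\<close>

lemma three_neutral_adjacent:
  assumes opt: "optimal f" and x: "x \<in> A" "f x = c"
    and neutral: "neutral f v1 c" "neutral f v2 c" "neutral f v3 c"
    and distinct: "v1 \<noteq> v2" "v1 \<noteq> v3" "v2 \<noteq> v3"
    and nonadj: "(v1, v2) \<notin> E" "(v1, v3) \<notin> E" "(v2, v3) \<notin> E"
    and touch: "nbrs f c v1 \<inter> (mono_arcs f)\<^sup>* `` {x} \<noteq> {}" "nbrs f c v2 \<inter> (mono_arcs f)\<^sup>* `` {x} \<noteq> {}"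
      "nbrs f c v3 \<inter> (mono_arcs f)\<^sup>* `` {x} \<noteq> {}"
  shows False
proof -
  define Q where "Q = (mono_arcs f)\<^sup>* `` {x}"
  have Q: "u \<in> A \<and> f u = c" if "u \<in> Q" for u
  proof -
    have "(x, u) \<in> (mono_arcs f)\<^sup>*" using that by (simp add: Q_def)
    then show ?thesis using x by (induction rule: rtrancl_induct) (auto simp: mono_arcs_def dest: E_simps(4))
  qed
  then have QA: "Q \<subseteq> A" and finQ: "finite Q" using finite_A by (auto intro: finite_subset[of Q A])
  define g1 g2 g where "g1 = f(v1 := c)" and "g2 = g1(v2 := c)" and "g = g2(v3 := c)"
  \<comment> \<open>Nonadjacency keeps the remaining recolourings neutral after the earlier ones
    have been made.\<close>
  have n2: "neutral g1 v2 c" and n3: "neutral g1 v3 c"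
    unfolding g1_def using neutral distinct nonadj by (auto intro!: neutral_upd)
  have n3': "neutral g2 v3 c"
    unfolding g2_def using n3 distinct nonadj by (auto intro!: neutral_upd)
  have opt_g: "optimal g"
    unfolding g_def g2_def g1_def
    using optimal_upd[OF optimal_upd[OF optimal_upd[OF opt neutral(1)]]] n2 n3'
    by (simp add: g1_def g2_def)
  have nc: "f v1 \<noteq> c" "g1 v2 \<noteq> c" "g2 v3 \<noteq> c"
    using neutral n2 n3' by (auto simp: neutral_def)
  have ne: "f v \<noteq> c" if "v \<in> {v1, v2, v3}" for v using neutral that by (auto simp: neutral_def)
  have deg: "card (nbrs g c u) = card (nbrs f c u) + of_bool (u \<in> E `` {v1}) + of_bool (u \<in> E `` {v2})
      + of_bool (u \<in> E `` {v3})" for u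
    using card_nbrs_upd[of f v1 c c u] card_nbrs_upd[of g1 v2 c c u] card_nbrs_upd[of g2 v3 c c u] nc
      E_simps(1)[of u] E_simps(1)[of _ u]
    by (auto simp: g1_def[symmetric] g2_def[symmetric] g_def[symmetric])
  have hit: "1 \<le> card (Q \<inter> E `` {v})" if "nbrs f c v \<inter> (mono_arcs f)\<^sup>* `` {x} \<noteq> {}" for v
  proof -
    have "Q \<inter> E `` {v} \<noteq> {}" using that by (auto simp: Q_def nbrs_def)
    then show ?thesis using finQ by (simp add: Suc_le_eq card_gt_0_iff)
  qed
  have "(\<Sum>u\<in>Q. card (nbrs g c u)) \<le> (\<Sum>u\<in>Q. 2)"
  proof (rule sum_mono)
    fix u assume "u \<in> Q"
    then have "u \<in> A" "f u = c" using Q by auto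
    moreover from this have "g u = c" using ne by (auto simp: g_def g2_def g1_def)
    ultimately show "card (nbrs g c u) \<le> 2" using optimal_degree[OF opt_g, of u] by simp
  qed
  moreover have "(\<Sum>u\<in>Q. card (nbrs g c u)) = (\<Sum>u\<in>Q. card (nbrs f c u)) + card (Q \<inter> E `` {v1})
      + card (Q \<inter> E `` {v2}) + card (Q \<inter> E `` {v3})"
    using finQ by (simp add: deg sum.distrib sum.If_cases of_bool_def Int_def Image_def)
  moreover have "1 \<le> card (Q \<inter> E `` {v1})" "1 \<le> card (Q \<inter> E `` {v2})" "1 \<le> card (Q \<inter> E `` {v3})"
    using touch hit by auto
  moreover have "2 * card Q \<le> (\<Sum>u\<in>Q. card (nbrs f c u)) + 2"
  proof -
    have "arc_count (mono_arcs f) Q Q \<le> (\<Sum>u\<in>Q. card (nbrs f c u))"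
      unfolding arc_count_def
    proof (rule sum_mono)
      fix u assume "u \<in> Q"
      then have "mono_arcs f `` {u} = nbrs f c u" using Q mono_arcs_Image by simp
      then show "card (mono_arcs f `` {u} \<inter> Q) \<le> card (nbrs f c u)" by (simp add: card_mono)
    qed
    then show ?thesis
      using linked_arc_count[OF finQ _ sym_mono irrefl_mono, of f] linked_rtrancl[OF sym_mono] by (simp add: Q_def)
  qed
  ultimately show False by simp
qed

text \<open>Two vertices recoloured alike can end up in one component by being adjacent or by
  attaching to the same old component. The case \<open>x = y\<close> is a common neighbour.\<close>

definition conflict :: "('a \<Rightarrow> 'c) \<Rightarrow> 'a \<times> 'c \<Rightarrow> 'a \<times> 'c \<Rightarrow> bool" where
  "conflict f a b \<longleftrightarrow> snd a = snd b \<and> fst a \<noteq> fst b \<and> ((fst a, fst b) \<in> E \<or>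
     (\<exists>x\<in>nbrs f (snd a) (fst a). \<exists>y\<in>nbrs f (snd b) (fst b). (x, y) \<in> (mono_arcs f)\<^sup>*))"

lemma symp_conflict: "symp (conflict f)"
proof -
  have sym: "(y, x) \<in> (mono_arcs f)\<^sup>*" if "(x, y) \<in> (mono_arcs f)\<^sup>*" for x y
    using that sym_rtrancl[OF sym_mono] by (auto dest: symD)
  show ?thesis
  proof (rule sympI)
    fix a b assume ab: "conflict f a b"
    show "conflict f b a"
    proof (cases "(fst a, fst b) \<in> E")
      case True
      then show ?thesis using ab E_simps(1) by (auto simp: conflict_def)
    next
      case False
      then obtain x y where "x \<in> nbrs f (snd a) (fst a)" "y \<in> nbrs f (snd b) (fst b)" "(y, x) \<in> (mono_arcs f)\<^sup>*"
        using ab sym unfolding conflict_def by blast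
      then show ?thesis using ab unfolding conflict_def by (metis (no_types))
    qed
  qed
qed

lemma card_conflict_le:
  assumes opt: "optimal f" and "neutral f v c" and W: "\<And>w c. (w, c) \<in> W \<Longrightarrow> neutral f w c"
  shows "card {b \<in> W. conflict f (v, c) b} \<le> 5 * k - 3"
proof -
  let ?touch = "\<lambda>x. {w. neutral f w c \<and> w \<noteq> v \<and> (v, w) \<notin> E \<and> nbrs f c w \<inter> (mono_arcs f)\<^sup>* `` {x} \<noteq> {}}"
  let ?adj = "E `` {v} - nbrs f c v"
  have v: "v \<in> A" "card (nbrs f c v) = 2" using assms(2) by (auto simp: neutral_def)
  have A: "?touch x \<subseteq> A" for x by (auto simp: neutral_def)
  have touch_le: "card (?touch x) \<le> k" if x: "x \<in> nbrs f c v" for x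
  proof (rule card_clique_le[OF opt A])
    have xA: "x \<in> A" "f x = c" using x E_simps by (auto simp: nbrs_def)
    have vx: "nbrs f c v \<inter> (mono_arcs f)\<^sup>* `` {x} \<noteq> {}" using x by auto
    fix u w assume "u \<in> ?touch x" "w \<in> ?touch x" "u \<noteq> w"
    then show "(u, w) \<in> E"
      using three_neutral_adjacent[OF opt xA assms(2), of u w, OF _ _ _ _ _ _ _ _ vx] by auto
  next
    fix w assume "w \<in> ?touch x"
    then show "card (nbrs f (f w) w) = 2" by (simp add: neutral_def)
  qed
  have "{b \<in> W. conflict f (v, c) b} \<subseteq> (\<lambda>w. (w, c)) ` (?adj \<union> (\<Union>x\<in>nbrs f c v. ?touch x))"
  proof
    fix b assume b: "b \<in> {b \<in> W. conflict f (v, c) b}"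
    then obtain w where w: "b = (w, c)" "w \<noteq> v" by (cases b) (auto simp: conflict_def)
    then have n: "neutral f w c" using b W by auto
    have "w \<in> ?adj \<union> (\<Union>x\<in>nbrs f c v. ?touch x)"
    proof (cases "(v, w) \<in> E")
      case True
      then show ?thesis using n by (auto simp: neutral_def nbrs_def)
    next
      case False
      then show ?thesis using b w n by (auto simp: conflict_def)
    qed
    then show "b \<in> (\<lambda>w. (w, c)) ` (?adj \<union> (\<Union>x\<in>nbrs f c v. ?touch x))" using w by blast
  qed
  moreover have fin: "finite (?adj \<union> (\<Union>x\<in>nbrs f c v. ?touch x))"
    using A finite_A by (auto intro: finite_subset)
  ultimately have "card {b \<in> W. conflict f (v, c) b} \<le> card (?adj \<union> (\<Union>x\<in>nbrs f c v. ?touch x))"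
    by (meson card_image_le card_mono finite_imageI le_trans)
  also have "\<dots> \<le> card ?adj + card (\<Union>x\<in>nbrs f c v. ?touch x)" by (rule card_Un_le)
  also have "card ?adj = card (E `` {v}) - 2"
    using v nbrs_sub by (simp add: card_Diff_subset)
  also have "card (\<Union>x\<in>nbrs f c v. ?touch x) \<le> (\<Sum>x\<in>nbrs f c v. card (?touch x))"
    by (intro card_UN_le) simp
  also have "\<dots> \<le> (\<Sum>x\<in>nbrs f c v. k)" using touch_le by (rule sum_mono)
  also have "\<dots> = 2 * k" using v by simp
  finally have "card {b \<in> W. conflict f (v, c) b} \<le> card (E `` {v}) - 2 + 2 * k" by simp
  moreover have "card (E `` {v}) + 1 \<le> 3 * k"
    using slack_pos[OF v(1)] lists[OF v(1)] by (simp add: slack_def)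
  ultimately show ?thesis using lists[OF v(1)] by linarith
qed

end

section \<open>Cutting the long components\<close>

context sparse_lists begin

lemma low_eq: "optimal f \<Longrightarrow> max_degree_two.low A (mono_arcs f) = {v \<in> A. card (nbrs f (f v) v) \<le> 1}"
  by (simp add: max_degree_two.low_def[OF max_degree_two_mono] mono_arcs_Image)

text \<open>The tree bound, \<open>sparse\<close> and \<open>slack_le_neutral\<close> combine:
  \<open>2 * card S - 2\<close> is less than the slack sum, which is at most the number of neutral
  pairs plus \<open>card S\<close>.\<close>

lemma card_neutral_pairs_ge:
  assumes opt: "optimal f" and S: "S \<subseteq> A" "linked (mono_arcs f) S" "S \<noteq> {}"
    and deg: "\<And>v. v \<in> S \<Longrightarrow> card (nbrs f (f v) v) = 2"
  shows "card S - 1 \<le> card (SIGMA v:S. {c. neutral f v c})"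
proof -
  have fin: "finite S" using S(1) finite_A by (rule finite_subset)
  have finN: "finite {c. neutral f v c}" if "v \<in> S" for v
    using finite_list[of v] that S(1) by (auto simp: neutral_def elim: finite_subset[rotated])
  have sub: "mono_arcs f `` {u} \<inter> S \<subseteq> E `` {u} \<inter> S" for u by (auto simp: mono_arcs_def)
  have "arc_count (mono_arcs f) S S \<le> arc_count E S S"
    unfolding arc_count_def using fin sub by (intro sum_mono card_mono) auto
  then have "2 * int (card S) - 2 \<le> int (arc_count E S S)"
    using linked_arc_count[OF fin S(2) sym_mono irrefl_mono] by simp
  also have "\<dots> < (\<Sum>v\<in>S. slack v)"
    using sparse[OF S(1,3)] by (simp add: slack_def)
  also have "\<dots> \<le> (\<Sum>v\<in>S. int (card {c. neutral f v c}) + 1)"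
    using slack_le_neutral[OF opt] S(1) deg by (intro sum_mono) auto
  also have "\<dots> = int (card (SIGMA v:S. {c. neutral f v c})) + int (card S)"
    using fin finN by (simp add: sum.distrib)
  finally show ?thesis by simp
qed

text \<open>In an inclusion-maximal family, an uncovered linked set of \<open>m\<close> or more
  vertices avoiding \<open>low\<close> would contain a further segment by
  \<open>linked_grow\<close>.\<close>

lemma ex_maximal_segments:
  assumes opt: "optimal f" and m: "1 \<le> m"
  shows "\<exists>F. (\<forall>S\<in>F. S \<subseteq> A \<and> linked (mono_arcs f) S \<and> card S = m \<and> S \<inter> max_degree_two.low A (mono_arcs f) = {}) \<and>
    pairwise disjnt F \<and>
    (\<forall>C\<subseteq>A. linked (mono_arcs f) C \<longrightarrow> C \<inter> max_degree_two.low A (mono_arcs f) = {} \<longrightarrow> C \<inter> \<Union>F = {} \<longrightarrow> card C < m)"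
proof -
  let ?low = "max_degree_two.low A (mono_arcs f)"
  define seg where "seg S \<longleftrightarrow> S \<subseteq> A \<and> linked (mono_arcs f) S \<and> card S = m \<and> S \<inter> ?low = {}" for S
  let ?FF = "{F. F \<subseteq> {S. seg S} \<and> pairwise disjnt F}"
  have "?FF \<subseteq> Pow (Pow A)" by (auto simp: seg_def)
  then have "finite ?FF" by (rule finite_subset) (simp add: finite_A)
  moreover have "{} \<in> ?FF" by simp
  ultimately obtain F where F: "F \<in> ?FF" and max: "\<forall>F'\<in>?FF. F \<subseteq> F' \<longrightarrow> F = F'"
    using finite_has_maximal[of ?FF] by (metis (no_types, lifting) empty_iff)
  show ?thesis
  proof (intro exI[of _ F] conjI allI impI)
    show "\<forall>S\<in>F. S \<subseteq> A \<and> linked (mono_arcs f) S \<and> card S = m \<and> S \<inter> ?low = {}"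
      using F by (auto simp: seg_def)
    show "pairwise disjnt F" using F by simp
    fix C assume C: "C \<subseteq> A" "linked (mono_arcs f) C" "C \<inter> ?low = {}" "C \<inter> \<Union>F = {}"
    show "card C < m"
    proof (rule ccontr)
      assume "\<not> card C < m"
      then have "m \<le> card C" by simp
      moreover have "finite C" using C(1) finite_A by (rule finite_subset)
      ultimately obtain X where X: "X \<subseteq> C" "card X = m" "linked (mono_arcs f) X"
        using linked_grow[OF _ C(2) sym_mono irrefl_mono m] by blast
      have "X \<noteq> {}" using X(2) m by auto
      have "seg X" using X C by (auto simp: seg_def)
      moreover have "disjnt X Y" if "Y \<in> F" for Y
        using X(1) C(4) that by (auto simp: disjnt_def)
      ultimately have "insert X F \<in> ?FF"
        using F by (auto simp: pairwise_insert disjnt_sym)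
      then have "F = insert X F" using bspec[OF max] by blast
      then have "X \<in> F" by blast
      then show False using X(1) C(4) \<open>X \<noteq> {}\<close> by blast
    qed
  qed
qed

lemma ex_bounded_colouring_large:
  assumes k: "2 \<le> k"
  shows "\<exists>g. colouring g \<and> (\<forall>Q\<subseteq>A. linked (mono_arcs g) Q \<longrightarrow> card Q \<le> 57 * (k - 1) + 6)"
proof -
  obtain f where opt: "optimal f" using ex_optimal by blast
  interpret M: max_degree_two A "mono_arcs f" by (rule max_degree_two_mono[OF opt])
  \<comment> \<open>\<open>D\<close> is the conflict bound of \<open>card_conflict_le\<close>. A
    segment of \<open>m\<close> vertices has at least \<open>m - 1 = 2 * D\<close> neutral
    recolourings, as many as the transversal theorem demands. The final estimate
    \<open>40 * k - 19 \<le> 57 * k - 51\<close> uses \<open>2 \<le> k\<close>.\<close>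
  define D where "D = 5 * k - 3"
  define m where "m = 2 * D + 1"
  have m: "1 \<le> m" "4 * m + 1 \<le> 57 * (k - 1) + 6" and D: "0 < D" using k by (auto simp: m_def D_def)
  obtain F where segments: "\<forall>S\<in>F. S \<subseteq> A \<and> linked (mono_arcs f) S \<and> card S = m \<and> S \<inter> M.low = {}"
      and disj: "pairwise disjnt F"
      and maximal: "\<forall>C\<subseteq>A. linked (mono_arcs f) C \<longrightarrow> C \<inter> M.low = {} \<longrightarrow> C \<inter> \<Union>F = {} \<longrightarrow> card C < m"
    using ex_maximal_segments[OF opt m(1)] by (elim exE conjE)
  note F = bspec[OF segments]
  have "F \<subseteq> Pow A" using F by blast
  then have finF: "finite F" using finite_A by (simp add: finite_subset)
  define W where "W = (SIGMA v:\<Union>F. {c. neutral f v c})"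
  define part where "part b = (THE S. S \<in> F \<and> fst b \<in> S)" for b :: "'a \<times> 'c"
  have part: "part b = S" if "S \<in> F" "fst b \<in> S" for S b
    unfolding part_def using that disj by (intro the_equality) (auto simp: pairwise_def disjnt_def)
  have W_sub: "W \<subseteq> (SIGMA v:A. l v)" by (auto simp: W_def neutral_def)
  have finW: "finite W"
    using W_sub by (rule finite_subset) (intro finite_SigmaI finite_A finite_list)
  have W_seg: "\<exists>S\<in>F. fst b \<in> S" if "b \<in> W" for b
    using that by (cases b) (simp add: W_def)
  have Wn: "neutral f w c" if "(w, c) \<in> W" for w c using that by (simp add: W_def)
  have deg: "card (nbrs f (f v) v) = 2" if "v \<in> S" "S \<in> F" for v S
  proof -
    have "v \<in> A" "v \<notin> M.low" using F[OF that(2)] that(1) by auto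
    then show ?thesis using optimal_degree[OF opt, of v] by (simp add: low_eq[OF opt])
  qed
  have "\<exists>t. (\<forall>S\<in>F. t S \<in> W \<and> part (t S) = S) \<and> (\<forall>S\<in>F. \<forall>S'\<in>F. S \<noteq> S' \<longrightarrow> \<not> conflict f (t S) (t S'))"
  proof (rule independent_transversal[OF finF finW symp_conflict D])
    fix b assume "b \<in> W"
    then have "neutral f (fst b) (snd b)" using Wn[of "fst b" "snd b"] by simp
    then show "card {b' \<in> W. conflict f b b'} \<le> D"
      using card_conflict_le[OF opt _ Wn, where v = "fst b" and c = "snd b" and W = W] by (simp add: D_def)
  next
    fix S assume S: "S \<in> F"
    have "S \<noteq> {}" using F[OF S] m(1) by auto
    then have "m - 1 \<le> card (SIGMA v:S. {c. neutral f v c})"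
      using card_neutral_pairs_ge[OF opt, of S] F[OF S] deg[OF _ S] by auto
    also have "(SIGMA v:S. {c. neutral f v c}) = {b \<in> W. part b = S}"
    proof -
      have "fst b \<in> S" if b: "b \<in> W" "part b = S" for b
      proof -
        obtain S' where "S' \<in> F" "fst b \<in> S'" using W_seg[OF b(1)] by blast
        then show ?thesis using part b(2) by auto
      qed
      then show ?thesis using part[OF S] S by (fastforce simp: W_def)
    qed
    finally show "2 * D \<le> card {b \<in> W. part b = S}" by (simp add: m_def)
  qed
  then obtain t where "\<forall>S\<in>F. t S \<in> W \<and> part (t S) = S"
      and "\<forall>S\<in>F. \<forall>S'\<in>F. S \<noteq> S' \<longrightarrow> \<not> conflict f (t S) (t S')"
    by (elim exE conjE)
  then have t: "t S \<in> W" "part (t S) = S" "S' \<in> F \<Longrightarrow> S \<noteq> S' \<Longrightarrow> \<not> conflict f (t S) (t S')"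
    if "S \<in> F" for S S' using that by simp_all
  have t_in: "fst (t S) \<in> S" if S: "S \<in> F" for S
  proof -
    obtain S' where "S' \<in> F" "fst (t S) \<in> S'" using W_seg[OF t(1)[OF S]] by blast
    then show ?thesis using part t(2)[OF S] by auto
  qed
  define J where "J = (\<lambda>S. fst (t S)) ` F"
  \<comment> \<open>\<open>part\<close> looks only at the vertex of a pair, so
    \<open>undefined\<close> is a dummy colour.\<close>
  define g where "g u = (if u \<in> J then snd (t (part (u, undefined))) else f u)" for u
  have g_J: "neutral f v (g v) \<and> (\<exists>S\<in>F. t S = (v, g v))" if v: "v \<in> J" for v
  proof -
    obtain S where S: "S \<in> F" "v = fst (t S)" using v by (auto simp: J_def)
    then have "part (v, undefined) = S" using part t_in by auto
    then have tS: "t S = (v, g v)" using S v by (simp add: g_def)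
    then have "neutral f v (g v)" using t(1)[OF S(1)] Wn by simp
    then show ?thesis using S(1) tS by blast
  qed
  have g_notJ: "g v = f v" if "v \<notin> J" for v using that by (simp add: g_def)
  have noconf: "\<not> conflict f (v, g v) (w, g w)" if vw: "v \<in> J" "w \<in> J" for v w
  proof -
    obtain S S' where S: "S \<in> F" "t S = (v, g v)" "S' \<in> F" "t S' = (w, g w)"
      using g_J[OF vw(1)] g_J[OF vw(2)] by blast
    show ?thesis
    proof (cases "S = S'")
      case True
      then show ?thesis using S by (simp add: conflict_def)
    next
      case False
      then show ?thesis using t(3)[OF S(1,3) False] S by simp
    qed
  qed
  have piece: "card Q \<le> 4 * m" "Q \<inter> M.low \<noteq> {} \<Longrightarrow> card Q \<le> 2 * m"
    if Q: "Q \<subseteq> A" "linked (mono_arcs f) Q" "Q \<inter> J = {}" for Q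
  proof -
    have "\<forall>S\<in>F. \<not> S \<subseteq> Q" using t_in Q(3) by (auto simp: J_def)
    then show "card Q \<le> 4 * m" "Q \<inter> M.low \<noteq> {} \<Longrightarrow> card Q \<le> 2 * m"
      using M.card_piece[OF segments disj m(1) maximal Q(1,2)] by blast+
  qed
  have J_low: "v \<notin> M.low" if "v \<in> J" for v
    using g_J[OF that] by (simp add: low_eq[OF opt] neutral_def)
  have "colouring g"
    unfolding colouring_def
  proof
    fix u assume "u \<in> A"
    then show "g u \<in> l u"
      using opt g_J[of u] g_notJ[of u] by (cases "u \<in> J") (auto simp: optimal_def colouring_def neutral_def)
  qed
  moreover have "card Q \<le> 57 * (k - 1) + 6" if Q: "Q \<subseteq> A" "linked (mono_arcs g) Q" for Q
  proof (cases "Q \<inter> J = {}")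
    case True
    have "g a = f a" if "a \<in> Q" for a using True that by (intro g_notJ) auto
    then have "mono_arcs g \<inter> Q \<times> Q \<subseteq> mono_arcs f" by (auto simp: mono_arcs_def)
    then have "linked (mono_arcs f) Q" by (rule linked_mono[OF Q(2)])
    then have "card Q \<le> 4 * m" using True by (intro piece(1)[OF Q(1)])
    then show ?thesis using m by simp
  next
    case False
    then obtain v where v: "v \<in> Q" "v \<in> J" by blast
    define c where "c = g v"
    have nv: "neutral f v c" using g_J[OF v(2)] by (simp add: c_def)
    define R where "R = mono_arcs f \<inter> (- J) \<times> (- J)"
    define P where "P x = R\<^sup>* `` {x}" for x
    \<comment> \<open>\<open>Z\<close> consists of \<open>v\<close> and the pieces, left after
      removing \<open>J\<close>, that its new colour joins. Each piece contains a neighbour of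
      \<open>v\<close>, which is low, so \<open>card_piece\<close> bounds it by
      \<open>2 * m\<close>.\<close>
    define Z where "Z = insert v (\<Union>x\<in>nbrs f c v. P x)"
    have symR: "sym R" using sym_mono[of f] by (auto simp: R_def sym_def)
    have N: "x \<in> A" "f x = c" "x \<in> M.low" "x \<notin> J" if "x \<in> nbrs f c v" for x
    proof -
      show "x \<in> A" "f x = c" using that E_simps by (auto simp: nbrs_def)
      then show "x \<in> M.low" using neutral_nbr[OF opt nv that] by (simp add: low_eq[OF opt])
      then show "x \<notin> J" using J_low by blast
    qed
    have P: "a \<in> A \<and> f a = c \<and> a \<notin> J \<and> (x, a) \<in> (mono_arcs f)\<^sup>*" if "a \<in> P x" "x \<in> nbrs f c v" for a x
    proof -
      have "(x, a) \<in> R\<^sup>*" using that(1) by (simp add: P_def)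
      then show ?thesis
      proof (induction rule: rtrancl_induct)
        case base
        then show ?case using N[OF that(2)] by simp
      next
        case (step y z)
        then show ?case
          by (auto simp: R_def mono_arcs_def dest: E_simps(4) intro: rtrancl_into_rtrancl)
      qed
    qed
    have cP: "card (P x) \<le> 2 * m" if x: "x \<in> nbrs f c v" for x
    proof (rule piece(2))
      show "P x \<subseteq> A" "P x \<inter> J = {}" using P x by blast+
      show "linked (mono_arcs f) (P x)"
        unfolding P_def by (rule linked_mono[OF linked_rtrancl[OF symR]]) (auto simp: R_def)
      show "P x \<inter> M.low \<noteq> {}" using N(3)[OF x] by (auto simp: P_def)
    qed
    have finP: "finite (P x)" if "x \<in> nbrs f c v" for x
      using P that finite_A by (auto intro: finite_subset[of _ A])
    \<comment> \<open>It suffices that no arc of \<open>mono_arcs g\<close> leaves \<open>Z\<close>.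
      An outer end \<open>b\<close> in \<open>J\<close> would be adjacent to \<open>v\<close> or
      attach to the same old component, which is a conflict. Any other outer end would be a
      neighbour of \<open>v\<close> of colour \<open>c\<close> or continue a piece, and so lie in
      \<open>Z\<close>.\<close>
    have "Q \<subseteq> Z"
    proof (rule ccontr)
      assume "\<not> Q \<subseteq> Z"
      then have "Q \<inter> Z \<noteq> Q" by blast
      moreover have "v \<in> Q \<inter> Z" using v by (simp add: Z_def)
      then have "Q \<inter> Z \<noteq> {}" by blast
      ultimately obtain a b where "a \<in> Q \<inter> Z" and b: "b \<in> Q" "b \<notin> Q \<inter> Z" and ab: "(a, b) \<in> mono_arcs g"
        using linkedE[OF Q(2) Int_lower1] by metis
      then have aZ: "a \<in> Z" and bZ: "b \<notin> Z" by auto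
      have E: "(a, b) \<in> E" "g a = g b" using ab by (auto simp: mono_arcs_def)
      have bv: "b \<noteq> v" using bZ by (simp add: Z_def)
      have "a = v \<or> (\<exists>x\<in>nbrs f c v. a \<in> P x)" using aZ unfolding Z_def by (simp only: insert_iff UN_iff)
      then consider "a = v" | x where "x \<in> nbrs f c v" "a \<in> P x" by blast
      moreover from this have "g a = c"
      proof cases
        case 2
        then show ?thesis using P[OF 2(2,1)] g_notJ by simp
      qed (simp add: c_def)
      then have gb: "g b = c" using E by simp
      ultimately show False
      proof cases
        case 1
        show False
        proof (cases "b \<in> J")
          case True
          then show False using noconf[OF v(2) True] E 1 gb bv by (simp add: conflict_def c_def)
        next
          case False
          then have "b \<in> nbrs f c v" using E 1 gb g_notJ by (auto simp: nbrs_def)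
          moreover have "b \<in> P b" by (simp add: P_def)
          ultimately show False using bZ unfolding Z_def by blast
        qed
      next
        case 2
        note Pa = P[OF 2(2,1)]
        show False
        proof (cases "b \<in> J")
          case True
          have "a \<in> nbrs f c b" using E E_simps(1) Pa by (auto simp: nbrs_def)
          then have "conflict f (v, c) (b, c)"
            using 2(1) Pa bv unfolding conflict_def by force
          then show False using noconf[OF v(2) True] gb by (simp add: c_def)
        next
          case False
          then have "(a, b) \<in> R" using E gb g_notJ Pa by (auto simp: R_def mono_arcs_def)
          then have "b \<in> P x" using 2(2) by (auto simp: P_def intro: rtrancl_into_rtrancl)
          then show False using bZ 2(1) unfolding Z_def by blast
        qed
      qed
    qed
    moreover have "finite Z" using finP by (auto simp: Z_def)
    ultimately have "card Q \<le> card Z" by (intro card_mono)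
    also have "card Z \<le> Suc (card (\<Union>x\<in>nbrs f c v. P x))" unfolding Z_def by (rule card_insert_le_m1) simp_all
    also have "card (\<Union>x\<in>nbrs f c v. P x) \<le> (\<Sum>x\<in>nbrs f c v. card (P x))"
      by (intro card_UN_le) simp
    also have "\<dots> \<le> (\<Sum>x\<in>nbrs f c v. 2 * m)" using cP by (rule sum_mono)
    also have "\<dots> = 4 * m" using nv by (simp add: neutral_def)
    finally show ?thesis using m by simp
  qed
  ultimately show ?thesis by blast
qed

text \<open>All lists met are singletons, so \<open>sparse\<close> gives
  \<open>2 * arc_count E Q Q < 3 * card Q\<close>, and the tree bound turns this into
  \<open>4 * card Q - 4 < 3 * card Q\<close>.\<close>

lemma card_linked_le_3:
  assumes k: "k \<le> 1" and Q: "Q \<subseteq> A" "linked E Q"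
  shows "card Q \<le> 3"
proof (cases "Q = {}")
  case False
  have fin: "finite Q" using Q(1) finite_A by (rule finite_subset)
  have deg: "int (arc_count E Q Q) \<le> (\<Sum>v\<in>Q. int (card (E `` {v})))"
    unfolding arc_count_def by (simp add: card_mono sum_mono)
  have l: "card (l v) = 1" if "v \<in> Q" for v using lists[of v] that Q(1) k by auto
  have "int (arc_count E Q Q) < (\<Sum>v\<in>Q. 3 * int (card (l v)) - int (card (E `` {v})))"
    by (rule sparse[OF Q(1) False])
  also have "\<dots> = 3 * int (card Q) - (\<Sum>v\<in>Q. int (card (E `` {v})))"
    using l by (simp add: sum_subtractf)
  finally show ?thesis using deg linked_arc_count[OF fin Q(2) sym_E irrefl_E] by linarith
qed simp

theorem ex_bounded_colouring:
  "\<exists>g. colouring g \<and> (\<forall>Q\<subseteq>A. linked (mono_arcs g) Q \<longrightarrow> card Q \<le> 57 * (k - 1) + 6)"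
proof (cases "2 \<le> k")
  case False
  obtain g where "optimal g" using ex_optimal by blast
  then have "colouring g" by (simp add: optimal_def)
  moreover have "card Q \<le> 57 * (k - 1) + 6" if "Q \<subseteq> A" "linked (mono_arcs g) Q" for Q
  proof -
    have "linked E Q" using that(2) by (rule linked_mono) (auto simp: mono_arcs_def)
    then show ?thesis using card_linked_le_3[OF _ that(1)] False by simp
  qed
  ultimately show ?thesis by blast
qed (rule ex_bounded_colouring_large)

end

section \<open>Reduction to the sparse part\<close>

text \<open>The set \<open>A\<close> is inclusion-minimal among the sets on which the density hypothesis, weighted towards
  the arcs leaving the set, still holds; deleting a part \<open>S\<close> that violates the conclusion would
  preserve the weighted density.\<close>

lemma ex_sparse_subset:
  fixes E :: "'a rel" and k :: nat
  assumes "finite U" "U \<noteq> {}" "sym E" and dense: "2 * arc_count E U U < 3 * k * card U"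
  shows "\<exists>A\<subseteq>U. A \<noteq> {} \<and> (\<forall>S\<subseteq>A. S \<noteq> {} \<longrightarrow> int (arc_count E S S)
    < (\<Sum>v\<in>S. 3 * (int k - int (card (E `` {v} \<inter> (U - A)))) - int (card (E `` {v} \<inter> A))))"
proof -
  \<comment> \<open>For \<open>X = U\<close> positivity of the weight is the density hypothesis. An
    arc leaving \<open>X\<close> costs 3, matching the loss of 3 in slack when a colour is deleted
    from a list.\<close>
  define weight where "weight X = 3 * int k * int (card X) - 2 * int (arc_count E X X) - 3 * int (arc_count E X (U - X))"
    for X
  define good where "good X \<longleftrightarrow> X \<subseteq> U \<and> X \<noteq> {} \<and> 0 < weight X" for X
  have "good U" using assms(2) dense[folded of_nat_less_iff[where ?'a = int]] by (simp add: good_def weight_def)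
  then obtain A where A: "good A" and min: "\<And>X. good X \<Longrightarrow> card A \<le> card X"
    using ex_has_least_nat[of good U card] by blast
  have AU: "A \<subseteq> U" "A \<noteq> {}" and finA: "finite A" using A assms(1) by (auto simp: good_def intro: finite_subset)
  have "int (arc_count E S S) < (\<Sum>v\<in>S. 3 * (int k - int (card (E `` {v} \<inter> (U - A)))) - int (card (E `` {v} \<inter> A)))"
    if S: "S \<subseteq> A" "S \<noteq> {}" for S
  proof -
    let ?T = "A - S"
    have fin: "finite S" "finite ?T" "finite (U - A)" using S finA assms(1) by (auto intro: finite_subset)
    have A_eq: "A = S \<union> ?T" using S by auto
    have U_eq: "U - ?T = (U - A) \<union> S" using S AU by auto
    have S_A: "arc_count E S A = arc_count E S S + arc_count E S ?T"
      using arc_count_Un_right[OF fin(1,2), of E S] A_eq by auto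
    have T_A: "arc_count E ?T A = arc_count E S ?T + arc_count E ?T ?T"
      using arc_count_Un_right[OF fin(1,2), of E ?T] A_eq arc_count_commute[OF fin(1,2) assms(3)] by auto
    have A_A: "arc_count E A A = arc_count E S A + arc_count E ?T A"
      using arc_count_Un_left[OF fin(1,2), of E A] A_eq by auto
    have A_out: "arc_count E A (U - A) = arc_count E S (U - A) + arc_count E ?T (U - A)"
      using arc_count_Un_left[OF fin(1,2), of E "U - A"] A_eq by auto
    have T_out: "arc_count E ?T (U - ?T) = arc_count E ?T (U - A) + arc_count E S ?T"
      unfolding U_eq using arc_count_Un_right[OF fin(3,1), of E ?T] S arc_count_commute[OF fin(1,2) assms(3)] by auto
    have card_A: "card A = card S + card ?T"
      using card_Un_disjoint[OF fin(1,2)] A_eq by auto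
    have "weight ?T \<le> 0"
    proof (cases "?T = {}")
      case True
      show ?thesis unfolding True by (simp add: weight_def)
    next
      case False
      moreover have "card ?T < card A" using S fin card_A by (simp add: card_gt_0_iff)
      ultimately have "\<not> good ?T" using min leD by blast
      then show ?thesis using False AU by (auto simp: good_def)
    qed
    moreover have "0 < weight A" using A by (simp add: good_def)
    \<comment> \<open>This is \<open>weight A - weight ?T > 0\<close> rearranged: arcs from
      \<open>S\<close> to \<open>?T\<close> cost 4 inside \<open>A\<close>, of which 3 are regained
      as arcs leaving \<open>?T\<close>.\<close>
    ultimately have "int (arc_count E S S) < 3 * int k * int (card S) - 3 * int (arc_count E S (U - A)) - int (arc_count E S A)"
      unfolding weight_def card_A A_A A_out T_out T_A S_A by (simp add: algebra_simps)
    also have "\<dots> = (\<Sum>v\<in>S. 3 * (int k - int (card (E `` {v} \<inter> (U - A)))) - int (card (E `` {v} \<inter> A)))"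
      by (simp add: arc_count_def right_diff_distrib sum_subtractf sum_distrib_left)
    finally show ?thesis .
  qed
  then show ?thesis using AU by blast
qed

text \<open>Induction colours \<open>U - A\<close> first. The lists on \<open>A\<close> then avoid
  the colours of outside neighbours, so no monochromatic linked set crosses between the two parts
  and both bounds survive.\<close>

lemma ex_bounded_list_colouring:
  fixes E :: "'a rel" and L :: "'a \<Rightarrow> 'c set" and k :: nat
  assumes V: "finite V" "sym E" "irrefl E"
    and L: "\<And>v. v \<in> V \<Longrightarrow> finite (L v) \<and> card (L v) = k"
    and dense: "\<And>S. S \<subseteq> V \<Longrightarrow> S \<noteq> {} \<Longrightarrow> 2 * arc_count E S S < 3 * k * card S"
    and "U \<subseteq> V"
  shows "\<exists>f. (\<forall>v\<in>U. f v \<in> L v) \<and>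
    (\<forall>Q\<subseteq>U. linked {(u, v) \<in> E. f u = f v} Q \<longrightarrow> card Q \<le> 57 * (k - 1) + 6)"
  using \<open>U \<subseteq> V\<close>
proof (induction "card U" arbitrary: U rule: less_induct)
  case less
  have finU: "finite U" using less.prems V(1) by (rule finite_subset)
  show ?case
  proof (cases "U = {}")
    case False
    obtain A where A: "A \<subseteq> U" "A \<noteq> {}" and sparse: "\<forall>S\<subseteq>A. S \<noteq> {} \<longrightarrow> int (arc_count E S S)
        < (\<Sum>v\<in>S. 3 * (int k - int (card (E `` {v} \<inter> (U - A)))) - int (card (E `` {v} \<inter> A)))"
      using ex_sparse_subset[OF finU False V(2) dense[OF less.prems False]] by (elim exE conjE)
    have "card (U - A) < card U" using A finU by (intro psubset_card_mono) auto
    then obtain g where g: "\<forall>v\<in>U - A. g v \<in> L v"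
        "\<forall>Q\<subseteq>U - A. linked {(u, v) \<in> E. g u = g v} Q \<longrightarrow> card Q \<le> 57 * (k - 1) + 6"
      using less.hyps[of "U - A"] less.prems by blast
    define out where "out v = E `` {v} \<inter> (U - A)" for v
    have fin_out: "finite (out v)" for v using finU by (simp add: out_def)
    have out_less: "card (out v) < k" if "v \<in> A" for v
      using sparse[rule_format, of "{v}"] that by (simp add: out_def)
    \<comment> \<open>The lists are cut down to exactly \<open>k - card (out v)\<close> colours, so
      that their slacks are exactly the summands in \<open>sparse\<close>.\<close>
    have "\<exists>l. l \<subseteq> L v - g ` out v \<and> card l = k - card (out v)" if "v \<in> A" for v
    proof -
      have "card (L v) - card (g ` out v) \<le> card (L v - g ` out v)"
        using fin_out by (intro diff_card_le_card_Diff) simp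
      moreover have "card (g ` out v) \<le> card (out v)" using fin_out by (rule card_image_le)
      ultimately have "k - card (out v) \<le> card (L v - g ` out v)"
        using L[of v] that A less.prems by auto
      then show ?thesis by (meson obtain_subset_with_card_n)
    qed
    then obtain l where l: "\<And>v. v \<in> A \<Longrightarrow> l v \<subseteq> L v - g ` out v" "\<And>v. v \<in> A \<Longrightarrow> card (l v) = k - card (out v)"
      by metis
    define E' where "E' = E \<inter> A \<times> A"
    have E'_Image: "E' `` {v} = E `` {v} \<inter> A" if "v \<in> A" for v using that by (auto simp: E'_def)
    interpret sparse_lists A E' l k
    proof
      show "finite A" using A(1) finU by (rule finite_subset)
      show "E' \<subseteq> A \<times> A" "sym E'" "irrefl E'" using V(2,3) by (auto simp: E'_def sym_def irrefl_def)
      show "1 \<le> card (l v) \<and> card (l v) \<le> k" if "v \<in> A" for v using l(2)[OF that] out_less[OF that] by simp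
      fix S assume S: "S \<subseteq> A" "S \<noteq> {}"
      have "arc_count E' S S = arc_count E S S"
        unfolding arc_count_def using S(1) by (intro sum.cong refl arg_cong[of _ _ card]) (auto simp: E'_def)
      moreover have "(\<Sum>v\<in>S. 3 * int (card (l v)) - int (card (E' `` {v})))
          = (\<Sum>v\<in>S. 3 * (int k - int (card (E `` {v} \<inter> (U - A)))) - int (card (E `` {v} \<inter> A)))"
      proof (rule sum.cong[OF refl])
        fix v assume "v \<in> S"
        then have "v \<in> A" using S by auto
        then show "3 * int (card (l v)) - int (card (E' `` {v}))
          = 3 * (int k - int (card (E `` {v} \<inter> (U - A)))) - int (card (E `` {v} \<inter> A))"
          using l(2) out_less E'_Image by (simp add: of_nat_diff out_def less_imp_le)
      qed
      ultimately show "int (arc_count E' S S) < (\<Sum>v\<in>S. 3 * int (card (l v)) - int (card (E' `` {v})))"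
        using sparse S by simp
    qed
    obtain h where h: "\<forall>v\<in>A. h v \<in> l v" "\<forall>Q\<subseteq>A. linked (mono_arcs h) Q \<longrightarrow> card Q \<le> 57 * (k - 1) + 6"
      using ex_bounded_colouring unfolding colouring_def by blast
    define f where "f v = (if v \<in> A then h v else g v)" for v
    have sep: "f a \<noteq> f b" if "a \<in> A" "b \<in> U - A" "(a, b) \<in> E" for a b
      using that h(1) l(1)[OF that(1)] by (auto simp: f_def out_def)
    have "f v \<in> L v" if "v \<in> U" for v
      using that h(1) g(1) l(1)[of v] by (auto simp: f_def)
    moreover have "card Q \<le> 57 * (k - 1) + 6" if Q: "Q \<subseteq> U" "linked {(u, v) \<in> E. f u = f v} Q" for Q
    proof -
      have "Q \<inter> A = {} \<or> Q \<inter> A = Q"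
      proof (rule ccontr)
        assume "\<not> ?thesis"
        then obtain a b where "a \<in> Q \<inter> A" "b \<in> Q" "b \<notin> Q \<inter> A" "(a, b) \<in> {(u, v) \<in> E. f u = f v}"
          using linkedE[OF Q(2), of "Q \<inter> A"] by blast
        then show False using sep[of a b] Q(1) by auto
      qed
      then show ?thesis
      proof
        assume "Q \<inter> A = {}"
        moreover from this have "f v = g v" if "v \<in> Q" for v using that by (auto simp: f_def)
        then have "linked {(u, v) \<in> E. g u = g v} Q"
          by (intro linked_mono[OF Q(2)]) auto
        ultimately show ?thesis using g(2) Q(1) by blast
      next
        assume "Q \<inter> A = Q"
        then have "Q \<subseteq> A" by blast
        moreover from this have "f v = h v" if "v \<in> Q" for v using that by (auto simp: f_def)
        then have "linked (mono_arcs h) Q"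
          using \<open>Q \<subseteq> A\<close> unfolding mono_arcs_def
          by (intro linked_mono[OF Q(2)]) (auto simp: E'_def)
        ultimately show ?thesis using h(2) by blast
      qed
    qed
    ultimately show ?thesis by blast
  qed simp
qed

section \<open>Translation from library graphs, components and average degrees\<close>

lemma linked_monochromatic_component:
  assumes "pair_graph G" "monochromatic_component G f H"
  shows "verts H \<subseteq> pverts G" "linked {(u, v) \<in> parcs G. f u = f v} (verts H)"
proof -
  interpret pair_graph G by fact
  let ?M = "{(u, v) \<in> parcs G. f u = f v}"
  let ?S = "mk_symmetric H"
  have sub: "subgraph H (with_proj (monochromatic_subgraph G f))" and con: "connected H"
    using assms(2) unfolding monochromatic_component_def pre_digraph.max_subgraph_def by auto
  have H: "verts H \<subseteq> pverts G" "arcs H \<subseteq> ?M" "tail H = fst" "head H = snd"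
    using sub by (auto simp: subgraph_def compatible_def monochromatic_subgraph_def)
  show "verts H \<subseteq> pverts G" by fact
  have symE: "(v, u) \<in> parcs G" if "(u, v) \<in> parcs G" for u v
    using pair_sym_arcs that by (auto simp: symmetric_def dest: symD)
  have "sym ?M" using symE by (auto simp: sym_def)
  \<comment> \<open>Connectedness of \<open>H\<close> refers to paths in its symmetric closure; as
    \<open>?M\<close> is symmetric, the closure adds no arcs outside \<open>?M\<close>.\<close>
  have S_M: "parcs ?S \<subseteq> ?M"
  proof
    fix a assume "a \<in> parcs ?S"
    then obtain e where e: "e \<in> arcs H" "a = (fst e, snd e) \<or> a = (snd e, fst e)"
      by (auto simp: mk_symmetric_def H(3,4))
    then have "(fst e, snd e) \<in> ?M" using H(2) by auto
    then show "a \<in> ?M" using e(2) symD[OF \<open>sym ?M\<close>] by blast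
  qed
  have "(u, v) \<in> rtrancl_on (verts H) (parcs ?S)" if "u \<in> verts H" "v \<in> verts H" for u v
    using con that by (simp add: connected_def strongly_connected_def reachable_def mk_symmetric_def)
  then have reach: "(u, v) \<in> rtrancl_on (verts H) ?M" if "u \<in> verts H" "v \<in> verts H" for u v
    using that by (intro rtrancl_on_mono[OF S_M order_refl])
  show "linked ?M (verts H)"
    unfolding linked_def
  proof (intro allI impI, rule ccontr)
    fix X assume X: "X \<subseteq> verts H" "X \<noteq> {}" "X \<noteq> verts H"
      and no: "\<not> (\<exists>x\<in>X. \<exists>y\<in>verts H - X. (x, y) \<in> ?M)"
    obtain x y where xy: "x \<in> X" "y \<in> verts H" "y \<notin> X" using X by blast
    have "(x, y) \<in> rtrancl_on (verts H) ?M" using xy X reach by blast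
    then have "y \<in> X"
      by (induction rule: rtrancl_on_induct) (use xy no in blast)+
    then show False using xy by simp
  qed
qed

text \<open>\<open>Max\<close> bounds its elements only for finite sets. A subgraph is determined by
  its vertex and arc sets, which leaves finitely many.\<close>

lemma finite_average_degrees:
  assumes "pair_graph G"
  shows "finite {average_degree H | H. pair_graph H \<and> subgraph (with_proj H) (with_proj G)}"
proof -
  interpret pair_graph G by fact
  have "{H. pair_graph H \<and> subgraph (with_proj H) (with_proj G)}
      \<subseteq> (\<lambda>(V, E). \<lparr>pverts = V, parcs = E\<rparr>) ` (Pow (pverts G) \<times> Pow (parcs G))" (is "?Hs \<subseteq> _")
  proof
    fix H :: "'a pair_pre_digraph" assume "H \<in> ?Hs"
    then have "(pverts H, parcs H) \<in> Pow (pverts G) \<times> Pow (parcs G)" by (auto simp: subgraph_def)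
    then show "H \<in> (\<lambda>(V, E). \<lparr>pverts = V, parcs = E\<rparr>) ` (Pow (pverts G) \<times> Pow (parcs G))"
      by (rule image_eqI[rotated]) simp
  qed
  then have "finite ?Hs"
    by (rule finite_subset) (simp add: pair_finite_verts pair_finite_arcs)
  then show ?thesis by (simp add: setcompr_eq_image)
qed

text \<open>The subgraph induced on \<open>S\<close> has average degree
  \<open>arc_count (parcs G) S S / card S\<close>; for empty \<open>S\<close> this quotient is
  \<open>0 / 0 = 0\<close>.\<close>

lemma arc_count_le_mad:
  assumes "pair_graph G" "S \<subseteq> pverts G"
  shows "real (arc_count (parcs G) S S) \<le> mad G * real (card S)" "0 \<le> mad G"
proof -
  interpret pair_graph G by fact
  define H where "H = \<lparr>pverts = S, parcs = parcs G \<inter> S \<times> S\<rparr>"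
  have fin: "finite S" using assms(2) pair_finite_verts by (rule finite_subset)
  have "pair_graph H"
  proof
    show "symmetric (with_proj H)"
      using pair_sym_arcs by (auto simp: symmetric_def H_def sym_def)
  qed (use fin pair_no_loops in \<open>auto simp: H_def\<close>)
  moreover have "subgraph (with_proj H) (with_proj G)"
  proof -
    have "wf_digraph (with_proj H)" "wf_digraph (with_proj G)"
      using in_arcsD1 in_arcsD2 by (unfold_locales; auto simp: H_def)+
    then show ?thesis using assms(2) by (auto simp: subgraph_def compatible_def H_def)
  qed
  ultimately have "average_degree H \<le> mad G"
    unfolding mad_def by (intro Max_ge finite_average_degrees assms(1)) blast
  moreover have "average_degree H = real (arc_count (parcs G) S S) / real (card S)"
  proof -
    have "out_degree (with_proj H) v = card (parcs G `` {v} \<inter> S)" if "v \<in> S" for v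
    proof -
      have "out_arcs (with_proj H) v = Pair v ` (parcs G `` {v} \<inter> S)"
        using that by (auto simp: out_arcs_def H_def)
      then show ?thesis by (simp add: out_degree_def card_image inj_on_def)
    qed
    then show ?thesis by (simp add: average_degree_def arc_count_def H_def)
  qed
  ultimately have le: "real (arc_count (parcs G) S S) / real (card S) \<le> mad G" by simp
  then show "0 \<le> mad G" by (rule order_trans[rotated]) simp
  show "real (arc_count (parcs G) S S) \<le> mad G * real (card S)"
  proof (cases "S = {}")
    case False
    then show ?thesis using le fin by (simp add: divide_le_eq card_gt_0_iff)
  qed simp
qed

theorem theorem6:
  fixes G :: "'a pair_pre_digraph"
  assumes "pair_graph G"
  shows "choosable_with_clustering TYPE('c) G
           (nat \<lfloor>2 / 3 * mad G + 1\<rfloor>) (57 * nat \<lfloor>2 / 3 * mad G\<rfloor> + 6)"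
  unfolding choosable_with_clustering_def
proof (intro allI impI)
  interpret pair_graph G by fact
  fix L :: "'a \<Rightarrow> 'c set"
  let ?E = "parcs G"
  define k where "k = nat \<lfloor>2 / 3 * mad G + 1\<rfloor>"
  assume "list_assignment G (nat \<lfloor>2 / 3 * mad G + 1\<rfloor>) L"
  then have L: "infinite (L v) \<or> k \<le> card (L v)" if "v \<in> pverts G" for v
    using that by (simp add: list_assignment_def k_def)
  have "0 \<le> mad G" using arc_count_le_mad(2)[OF assms, of "{}"] by simp
  \<comment> \<open>Nonnegativity of \<open>mad G\<close> makes \<open>nat\<close> harmless here,
    and the added 1 exceeds the fractional part lost by the floor, which gives the strict
    inequality.\<close>
  then have k: "k - 1 = nat \<lfloor>2 / 3 * mad G\<rfloor>" "2 * mad G < 3 * real k"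
    unfolding k_def by linarith+
  \<comment> \<open>Lists may be larger than \<open>k\<close> or infinite; sublists of exactly
    \<open>k\<close> colours suit \<open>ex_bounded_list_colouring\<close>.\<close>
  have "\<exists>l. l \<subseteq> L v \<and> finite l \<and> card l = k" if "v \<in> pverts G" for v
    using L[OF that] by (meson infinite_arbitrarily_large obtain_subset_with_card_n)
  then obtain l where l: "\<And>v. v \<in> pverts G \<Longrightarrow> l v \<subseteq> L v \<and> finite (l v) \<and> card (l v) = k" by metis
  have "sym ?E" "irrefl ?E"
    using pair_sym_arcs pair_no_loops by (fastforce simp: symmetric_def irrefl_def)+
  moreover have "2 * arc_count ?E S S < 3 * k * card S" if S: "S \<subseteq> pverts G" "S \<noteq> {}" for S
  proof -
    have "0 < card S" using S pair_finite_verts by (auto simp: card_gt_0_iff intro: finite_subset)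
    then have "2 * mad G * real (card S) < 3 * real k * real (card S)" using k(2) by simp
    then have "2 * real (arc_count ?E S S) < 3 * real k * real (card S)"
      using arc_count_le_mad(1)[OF assms S(1)] by linarith
    then have "real (2 * arc_count ?E S S) < real (3 * k * card S)" by simp
    then show ?thesis by (simp only: of_nat_less_iff)
  qed
  ultimately obtain f where f: "\<forall>v\<in>pverts G. f v \<in> l v"
      "\<forall>Q\<subseteq>pverts G. linked {(u, v) \<in> ?E. f u = f v} Q \<longrightarrow> card Q \<le> 57 * (k - 1) + 6"
    using ex_bounded_list_colouring[OF pair_finite_verts, of ?E l k "pverts G"] l by blast
  have "list_colouring G L f" using f(1) l by (auto simp: list_colouring_def)
  moreover have "has_clustering G f (57 * nat \<lfloor>2 / 3 * mad G\<rfloor> + 6)"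
    using f(2) linked_monochromatic_component[OF assms] unfolding has_clustering_def k(1)[symmetric] by blast
  ultimately show "\<exists>f. list_colouring G L f \<and> has_clustering G f (57 * nat \<lfloor>2 / 3 * mad G\<rfloor> + 6)" by blast
qed

end
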